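(* Let $0<M_1<M_2$ and $R_2>R_1>2M_2$. There is a constant $C$, depending only on $M_1,M_2,R_1,R_2$, such that the following holds for every $u\in\mathcal A_{BV}$ with $\delta[u]:=\mathcal J[u]-\lambda_*\le1$. If $a=x_0$, then $$\int|r-a|^2\,d(Du)^+(r)\le C\delta[u],\qquad \int(R_2-r)\,d(Du)^-(r)\le C\delta[u],\qquad \|u-u_*\|_{L^1}\le C\sqrt{\delta[u]},$$ and moreover $$\|P_u-P_*\|_{L^\infty}+\|m_u-m_*\|_{L^\infty}+\|F_u-F_*\|_{L^\infty}+\|F_u^{-1}-F_*^{-1}\|_{L^\infty}\le C\sqrt{\delta[u]}.$$ If $a=R_1>x_0$, then $$\int(r-R_1)\,d(Du)^+(r)\le C\delta[u],\qquad \int(R_2-r)\,d(Du)^-(r)\le C\delta[u],$$ $$\|u-u_*\|_{L^1}\le C\delta[u],$$ $$\|P_u-P_*\|_{L^\infty}+\|m_u-m_*\|_{L^\infty}+\|F_u-F_*\|_{L^\infty}+\|F_u^{-1}-F_*^{-1}\|_{L^\infty}\le C\delta[u].$$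
   Context: $\Delta M:=M_2-M_1$. $\mathcal A_{BV}$: functions $u\in BV(\mathbb R)$ (so $u\in L^1(\mathbb R)$ and $Du$ is a finite signed Radon measure on $\mathbb R$) with $u\ge0$ a.e., $u=0$ a.e. on $\mathbb R\setminus[R_1,R_2]$, $\int_{R_1}^{R_2}r^2u\,dr=1$. $Du=(Du)^+-(Du)^-$ is the Jordan decomposition. For $u\in\mathcal A_{BV}$: $P_u(r)=\int_{R_1}^r s^2u(s)\,ds$, $m_u=M_1+\Delta M\,P_u$, $F_u(r)=1-2m_u(r)/r$ on $[R_1,R_2]$ (so $F_u\ge1-2M_2/R_1>0$). $L^\infty$ norms are over $[R_1,R_2]$. $\mathcal J[u]=\int_{[R_1,R_2]}\frac{r^3}{\sqrt{F_u(r)}}\,d(Du)^+(r)$. $A(r)=\frac{R_2^3-r^3}{3}$, $q(r)=\frac{r^{7/2}}{\sqrt{r-2M_1}}$, $\Psi=q/A$. $x_0$ is the unique real solution of $M_1x_0^3+3R_2^3x_0-7M_1R_2^3=0$ (it satisfies $2M_1<x_0<7M_1/3$ and $x_0<R_2$). $a=\max\{R_1,x_0\}$, $\lambda_*=\Psi(a)$ (this is the minimum of $\mathcal J$ over $\mathcal A_{BV}$), $H_*=1/A(a)$, $u_*=H_*\mathbf 1_{(a,R_2)}$, $P_*=P_{u_*}$, $m_*=m_{u_*}$, $F_*=F_{u_*}$. *)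

theory Defs
  imports "HOL-Analysis.Analysis" "HOL-Probability.Essential_Supremum"
begin

section \<open>Functions of bounded variation on the line\<close>

definition test_function :: "(real \<Rightarrow> real) \<Rightarrow> bool" where
  "test_function \<phi> \<longleftrightarrow> \<phi> C1_differentiable_on UNIV \<and> compact (closure {x. \<phi> x \<noteq> 0})"

text \<open>
  The finite signed Radon measure \<open>Du\<close> is represented by its Jordan decomposition:
  \<open>\<mu>\<close> is \<open>(Du)\<^sup>+\<close> and \<open>\<nu>\<close> is \<open>(Du)\<^sup>-\<close>, two mutually singular finite Borel measures (which are
  automatically Radon on the line) such that \<open>\<mu> - \<nu>\<close> is the distributional derivative of \<open>u\<close>.
\<close>

definition is_jordan_derivative :: "(real \<Rightarrow> real) \<Rightarrow> real measure \<Rightarrow> real measure \<Rightarrow> bool" where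
  "is_jordan_derivative u \<mu> \<nu> \<longleftrightarrow>
     sets \<mu> = sets borel \<and> finite_measure \<mu> \<and>
     sets \<nu> = sets borel \<and> finite_measure \<nu> \<and>
     (\<exists>S \<in> sets borel. emeasure \<mu> (- S) = 0 \<and> emeasure \<nu> S = 0) \<and>
     (\<forall>\<phi>. test_function \<phi> \<longrightarrow>
        (LINT x|lebesgue. u x * deriv \<phi> x) = - ((LINT x|\<mu>. \<phi> x) - (LINT x|\<nu>. \<phi> x)))"

definition BV :: "(real \<Rightarrow> real) set" where
  "BV = {u. integrable lebesgue u \<and> (\<exists>\<mu> \<nu>. is_jordan_derivative u \<mu> \<nu>)}"

text \<open>
  For \<open>u \<in> BV\<close> the pair \<open>(\<mu>, \<nu>)\<close> is unique, so the choice below is no choice at all.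
\<close>

definition jordan_derivative :: "(real \<Rightarrow> real) \<Rightarrow> real measure \<times> real measure" where
  "jordan_derivative u = (SOME (\<mu>, \<nu>). is_jordan_derivative u \<mu> \<nu>)"

definition Du_pos :: "(real \<Rightarrow> real) \<Rightarrow> real measure" where
  "Du_pos u = fst (jordan_derivative u)"

definition Du_neg :: "(real \<Rightarrow> real) \<Rightarrow> real measure" where
  "Du_neg u = snd (jordan_derivative u)"

definition L1_norm :: "(real \<Rightarrow> real) \<Rightarrow> real" where
  "L1_norm f = (LINT r|lebesgue. \<bar>f r\<bar>)"

definition Linf_norm :: "real \<Rightarrow> real \<Rightarrow> (real \<Rightarrow> real) \<Rightarrow> ereal" where
  "Linf_norm R1 R2 f = esssup (restrict_space lebesgue {R1..R2}) (\<lambda>r. ereal \<bar>f r\<bar>)"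

section \<open>The variational problem\<close>

definition A_BV :: "real \<Rightarrow> real \<Rightarrow> (real \<Rightarrow> real) set" where
  "A_BV R1 R2 = {u \<in> BV. (AE r in lebesgue. 0 \<le> u r) \<and>
     (AE r in lebesgue. r \<notin> {R1..R2} \<longrightarrow> u r = 0) \<and>
     (LINT r:{R1..R2}|lebesgue. r\<^sup>2 * u r) = 1}"

definition P_fun :: "real \<Rightarrow> (real \<Rightarrow> real) \<Rightarrow> real \<Rightarrow> real" where
  "P_fun R1 u r = (LINT s:{R1..r}|lebesgue. s\<^sup>2 * u s)"

definition m_fun :: "real \<Rightarrow> real \<Rightarrow> real \<Rightarrow> (real \<Rightarrow> real) \<Rightarrow> real \<Rightarrow> real" where
  "m_fun M1 M2 R1 u r = M1 + (M2 - M1) * P_fun R1 u r"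

definition F_fun :: "real \<Rightarrow> real \<Rightarrow> real \<Rightarrow> (real \<Rightarrow> real) \<Rightarrow> real \<Rightarrow> real" where
  "F_fun M1 M2 R1 u r = 1 - 2 * m_fun M1 M2 R1 u r / r"

definition J :: "real \<Rightarrow> real \<Rightarrow> real \<Rightarrow> real \<Rightarrow> (real \<Rightarrow> real) \<Rightarrow> real" where
  "J M1 M2 R1 R2 u = (LINT r:{R1..R2}|Du_pos u. r ^ 3 / sqrt (F_fun M1 M2 R1 u r))"

section \<open>The minimum and the minimizer\<close>

definition A_fun :: "real \<Rightarrow> real \<Rightarrow> real" where
  "A_fun R2 r = (R2 ^ 3 - r ^ 3) / 3"

definition q_fun :: "real \<Rightarrow> real \<Rightarrow> real" where
  "q_fun M1 r = r powr (7 / 2) / sqrt (r - 2 * M1)"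

definition Psi :: "real \<Rightarrow> real \<Rightarrow> real \<Rightarrow> real" where
  "Psi M1 R2 r = q_fun M1 r / A_fun R2 r"

definition x0 :: "real \<Rightarrow> real \<Rightarrow> real" where
  "x0 M1 R2 = (THE x. M1 * x ^ 3 + 3 * R2 ^ 3 * x - 7 * M1 * R2 ^ 3 = 0)"

definition a_opt :: "real \<Rightarrow> real \<Rightarrow> real \<Rightarrow> real" where
  "a_opt M1 R1 R2 = max R1 (x0 M1 R2)"

definition lambda_star :: "real \<Rightarrow> real \<Rightarrow> real \<Rightarrow> real" where
  "lambda_star M1 R1 R2 = Psi M1 R2 (a_opt M1 R1 R2)"

definition H_star :: "real \<Rightarrow> real \<Rightarrow> real \<Rightarrow> real" where
  "H_star M1 R1 R2 = 1 / A_fun R2 (a_opt M1 R1 R2)"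

definition u_star :: "real \<Rightarrow> real \<Rightarrow> real \<Rightarrow> real \<Rightarrow> real" where
  "u_star M1 R1 R2 r = H_star M1 R1 R2 * indicator {a_opt M1 R1 R2 <..< R2} r"

definition deficit :: "real \<Rightarrow> real \<Rightarrow> real \<Rightarrow> real \<Rightarrow> (real \<Rightarrow> real) \<Rightarrow> real" where
  "deficit M1 M2 R1 R2 u = J M1 M2 R1 R2 u - lambda_star M1 R1 R2"

text \<open>
  \<open>\<parallel>P\<^sub>u - P\<^sub>*\<parallel> + \<parallel>m\<^sub>u - m\<^sub>*\<parallel> + \<parallel>F\<^sub>u - F\<^sub>*\<parallel> + \<parallel>1/F\<^sub>u - 1/F\<^sub>*\<parallel>\<close>, all norms being \<open>L\<^sup>\<infinity>\<close> norms
  on \<open>[R1, R2]\<close>.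
\<close>

definition profile_distance :: "real \<Rightarrow> real \<Rightarrow> real \<Rightarrow> real \<Rightarrow> (real \<Rightarrow> real) \<Rightarrow> ereal" where
  "profile_distance M1 M2 R1 R2 u =
     (let us = u_star M1 R1 R2;
          P = P_fun R1; m = m_fun M1 M2 R1; F = F_fun M1 M2 R1
      in Linf_norm R1 R2 (\<lambda>r. P u r - P us r)
       + Linf_norm R1 R2 (\<lambda>r. m u r - m us r)
       + Linf_norm R1 R2 (\<lambda>r. F u r - F us r)
       + Linf_norm R1 R2 (\<lambda>r. inverse (F u r) - inverse (F us r)))"

end

theory Submission
  imports Defs "HOL-Probability.Distribution_Functions" "HOL-Real_Asymp.Real_Asymp"
begin

text \<open>
  Since \<open>m\<^sub>u \<ge> M\<^sub>1\<close>, the integrand of \<open>\<J>\<close> dominates \<open>q\<close>, and testing \<open>Du\<close> against an antiderivative of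
  \<open>r\<^sup>2\<close> turns the mass constraint into \<open>\<integral>A d(Du)\<^sup>+ - \<integral>A d(Du)\<^sup>- = 1\<close>. Hence
  \<open>\<delta>[u] \<ge> \<integral>(q - \<lambda>\<^sub>*A) d(Du)\<^sup>+ + \<lambda>\<^sub>* \<integral>A d(Du)\<^sup>-\<close>,
  with both terms nonnegative. As \<open>q\<close> is convex and \<open>-A\<close> is a cubic, the gap \<open>q - \<lambda>\<^sub>*A\<close> grows at least
  quadratically away from \<open>a\<close> when its derivative vanishes there (\<open>a = x\<^sub>0\<close>) and at least linearly when
  that derivative is positive (\<open>a = R\<^sub>1 > x\<^sub>0\<close>). This controls the moments of \<open>(Du)\<^sup>\<plusminus>\<close>.
  Finally \<open>u\<close> is a.e. the difference of the distribution functions of \<open>(Du)\<^sup>+\<close> and \<open>(Du)\<^sup>-\<close>, so Fubini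
  bounds \<open>\<parallel>u - u\<^sub>*\<parallel>\<close> in \<open>L\<^sup>1\<close> by the first moments (with a Cauchy-Schwarz loss in the quadratic case),
  and the profiles \<open>P, m, F, 1/F\<close> depend on \<open>u\<close> in a Lipschitz way from \<open>L\<^sup>1\<close> to \<open>L\<^sup>\<infinity>\<close>.
\<close>

section \<open>Distribution functions and distributional derivatives\<close>

text \<open>Fubini for the kernel that is 1 when \<open>x \<le> r\<close> and 0 otherwise:
  integrating it over \<open>x\<close> gives \<open>cdf M r\<close>, integrating it against
  \<open>f\<close> over \<open>r\<close> gives the tail integral of \<open>f\<close>.\<close>

lemma (in finite_borel_measure) 
  fixes f :: "real \<Rightarrow> real"
  assumes f: "integrable lborel f"
  shows integrable_mult_cdf: "integrable lborel (\<lambda>r. f r * cdf M r)"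
    and integral_mult_cdf:
      "(LINT r|lborel. f r * cdf M r) = (LINT x|M. (LINT r|lborel. f r * indicator {x..} r))"
proof -
  note [measurable_cong] = M_is_borel
  have [measurable]: "f \<in> borel_measurable borel" using f by simp
  interpret P: pair_sigma_finite lborel M
    by (intro pair_sigma_finite.intro lborel.sigma_finite_measure_axioms sigma_finite_measure_axioms)
  define h where "h r x = f r * (if x \<le> r then 1 else 0)" for r x :: real
  \<comment> \<open>The same kernel read as a half-line in \<open>x\<close> for the inner
    \<open>M\<close>-integral and as a half-line in \<open>r\<close> for the inner Lebesgue
    integral.\<close>
  have hi: "h r x = f r * indicator {..r} x" "h r x = f r * indicator {x..} r" for r x
    by (auto simp: h_def indicator_def)
  have m: "case_prod h \<in> borel_measurable (lborel \<Otimes>\<^sub>M M)"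
    unfolding h_def by measurable
  have [measurable]: "cdf M \<in> borel_measurable borel"
    by (intro borel_measurable_mono monoI cdf_nondecreasing)
  have inner: "(LINT x|M. c * indicator {..r} x) = c * cdf M r" for c r :: real
    by (simp add: cdf_def borel_UNIV)
  show int: "integrable lborel (\<lambda>r. f r * cdf M r)"
  proof (rule Bochner_Integration.integrable_bound)
    show "integrable lborel (\<lambda>r. f r * measure M (space M))" using f by simp
    show "AE r in lborel. norm (f r * cdf M r) \<le> norm (f r * measure M (space M))"
      by (auto simp: abs_mult cdf_nonneg intro!: mult_left_mono cdf_bounded)
  qed simp
  have "integrable (lborel \<Otimes>\<^sub>M M) (case_prod h)"
  proof (rule P.Fubini_integrable[OF m])
    have "(\<lambda>r. LINT x|M. norm (case_prod h (r, x))) = (\<lambda>r. \<bar>f r * cdf M r\<bar>)"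
      by (simp add: hi(1) abs_mult inner cdf_nonneg del: Bochner_Integration.integral_mult_right_zero
        Bochner_Integration.integral_mult_right integral_indicator)
    then show "integrable lborel (\<lambda>r. LINT x|M. norm (case_prod h (r, x)))"
      using int by simp
    show "AE r in lborel. integrable M (\<lambda>x. case_prod h (r, x))"
      by (simp add: hi(1) emeasure_eq_measure M_is_borel)
  qed
  from P.Fubini_integral[OF this]
  show "(LINT r|lborel. f r * cdf M r) = (LINT x|M. (LINT r|lborel. f r * indicator {x..} r))"
    by (simp only: hi(1) inner) (simp only: hi(1)[symmetric] hi(2))
qed

text \<open>Integration by parts: the distributional derivative of \<open>cdf M\<close> is
  \<open>M\<close>. The tail integral of \<open>\<psi>\<close> from \<open>x\<close> is
  \<open>- \<phi> x\<close>, because \<open>\<phi>\<close> vanishes far to the right.\<close>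

lemma (in finite_borel_measure) integral_deriv_mult_cdf:
  fixes \<phi> \<psi> :: "real \<Rightarrow> real"
  assumes deriv: "\<And>x. (\<phi> has_real_derivative \<psi> x) (at x)" and cont: "continuous_on UNIV \<psi>"
    and \<phi>0: "\<And>x. x \<notin> {c<..<d} \<Longrightarrow> \<phi> x = 0" and \<psi>0: "\<And>x. x \<notin> {c<..<d} \<Longrightarrow> \<psi> x = 0"
  shows "integrable lborel (\<lambda>r. \<psi> r * cdf M r)"
    and "(LINT r|lborel. \<psi> r * cdf M r) = - (LINT x|M. \<phi> x)"
proof -
  have ind: "(LINT r|lborel. \<psi> r * indicator {a..b} r) = \<phi> b - \<phi> a"
       "integrable lborel (\<lambda>r. \<psi> r * indicator {a..b} r)" if "a \<le> b" for a b
  proof -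
    have "has_bochner_integral lborel (\<lambda>x. indicator {a..b} x *\<^sub>R \<psi> x) (\<phi> b - \<phi> a)"
      by (rule has_bochner_integral_FTC_Icc)
        (use that deriv cont in \<open>auto simp flip: has_real_derivative_iff_has_vector_derivative
           intro: has_field_derivative_at_within continuous_on_subset\<close>)
    then show "(LINT r|lborel. \<psi> r * indicator {a..b} r) = \<phi> b - \<phi> a"
       "integrable lborel (\<lambda>r. \<psi> r * indicator {a..b} r)"
      by (auto simp: has_bochner_integral_iff mult.commute)
  qed
  \<comment> \<open>\<open>max c d\<close> keeps the interval well ordered even when
    \<open>{c<..<d}\<close> is empty.\<close>
  have \<psi>_ind: "\<psi> r = \<psi> r * indicator {c..max c d} r" for r
    using \<psi>0[of r] by (cases "r \<in> {c<..<d}") (auto simp: indicator_def max_def)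
  have int: "integrable lborel \<psi>"
    using ind(2)[of c "max c d"] unfolding \<psi>_ind[symmetric] by simp
  have tail: "(LINT r|lborel. \<psi> r * indicator {x..} r) = - \<phi> x" for x
  proof -
    have "(\<lambda>r. \<psi> r * indicator {x..} r) = (\<lambda>r. \<psi> r * indicator {x..max x d} r)"
    proof
      fix r show "\<psi> r * indicator {x..} r = \<psi> r * indicator {x..max x d} r"
        using \<psi>0[of r] by (cases "r \<in> {c<..<d}") (auto simp: indicator_def max_def)
    qed
    then show ?thesis using ind(1)[of x "max x d"] \<phi>0[of "max x d"] by simp
  qed
  show "integrable lborel (\<lambda>r. \<psi> r * cdf M r)" by (rule integrable_mult_cdf[OF int])
  show "(LINT r|lborel. \<psi> r * cdf M r) = - (LINT x|M. \<phi> x)"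
    by (simp add: integral_mult_cdf[OF int] tail)
qed

text \<open>The positive and negative parts of \<open>g\<close> are densities of two finite measures
  that agree on all half-lines, hence everywhere; uniqueness of densities then equates the two parts
  a.e.\<close>

lemma AE_zero_if_tail_integrals_zero:
  fixes g :: "real \<Rightarrow> real"
  assumes g: "integrable lborel g"
    and tails: "\<And>x. (LINT r|lborel. g r * indicator {x<..} r) = 0"
  shows "AE r in lborel. g r = 0"
proof -
  have [measurable]: "g \<in> borel_measurable borel" using g by simp
  let ?p = "\<lambda>r. max 0 (g r)" and ?n = "\<lambda>r. max 0 (- g r)"
  have ip: "integrable lborel (\<lambda>r. ?p r * indicator {x<..} r)"
    and iN: "integrable lborel (\<lambda>r. ?n r * indicator {x<..} r)" for x
    by (rule Bochner_Integration.integrable_bound[OF g]; auto simp: indicator_def)+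
  have eqI: "(LINT r|lborel. ?p r * indicator {x<..} r) = (LINT r|lborel. ?n r * indicator {x<..} r)" for x
  proof -
    have "(LINT r|lborel. ?p r * indicator {x<..} r) - (LINT r|lborel. ?n r * indicator {x<..} r)
        = (LINT r|lborel. g r * indicator {x<..} r)"
      by (subst Bochner_Integration.integral_diff[symmetric, OF ip iN])
        (auto intro!: Bochner_Integration.integral_cong simp: indicator_def)
    then show ?thesis using tails by simp
  qed
  have em: "emeasure (density lborel (\<lambda>r. ennreal (h r))) {x<..}
      = ennreal (LINT r|lborel. h r * indicator {x<..} r)"
    if "integrable lborel (\<lambda>r. h r * indicator {x<..} r)" "\<And>r. 0 \<le> h r" "h \<in> borel_measurable borel"
    for h and x :: real
  proof -
    have "emeasure (density lborel (\<lambda>r. ennreal (h r))) {x<..}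
        = (\<integral>\<^sup>+r. ennreal (h r * indicator {x<..} r) \<partial>lborel)"
      using that by (subst emeasure_density) (auto intro!: nn_integral_cong split: split_indicator)
    then show ?thesis using that by (simp add: nn_integral_eq_integral)
  qed
  have "density lborel (\<lambda>r. ennreal (?p r)) = density lborel (\<lambda>r. ennreal (?n r))"
    by (rule measure_eqI_lessThan) (simp_all add: em ip iN eqI)
  then have "AE r in lborel. ennreal (?p r) = ennreal (?n r)"
    by (intro sigma_finite_measure.density_unique[OF lborel.sigma_finite_measure_axioms]) auto
  then show ?thesis by eventually_elim (auto simp: max_def split: if_splits)
qed

lemma finite_borel_measure_jordan:
  assumes "is_jordan_derivative u \<mu> \<nu>"
  shows "finite_borel_measure \<mu>" "finite_borel_measure \<nu>"
  using assms
  by (simp_all add: is_jordan_derivative_def finite_borel_measure_def finite_borel_measure_axioms_def)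

text \<open>\<open>u\<close> and \<open>cdf \<mu> - cdf \<nu>\<close> have the same distributional
  derivative, so their difference annihilates derivatives of test functions. The Borel
  representative \<open>v\<close> moves the integrals from \<open>lebesgue\<close> to
  \<open>lborel\<close>.\<close>

lemma test_integral_representation:
  fixes u \<phi> \<psi> :: "real \<Rightarrow> real"
  assumes jd: "is_jordan_derivative u \<mu> \<nu>" and u: "u \<in> borel_measurable lebesgue"
    and v: "integrable lborel v" and uv: "AE r in lebesgue. u r = v r"
    and deriv: "\<And>x. (\<phi> has_real_derivative \<psi> x) (at x)" and cont: "continuous_on UNIV \<psi>"
    and \<phi>0: "\<And>x. x \<notin> {c<..<d} \<Longrightarrow> \<phi> x = 0" and \<psi>0: "\<And>x. x \<notin> {c<..<d} \<Longrightarrow> \<psi> x = 0"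
  shows "integrable lborel (\<lambda>r. (v r - (cdf \<mu> r - cdf \<nu> r)) * \<psi> r)"
    and "(LINT r|lborel. (v r - (cdf \<mu> r - cdf \<nu> r)) * \<psi> r) = 0"
proof -
  interpret m: finite_borel_measure \<mu> by (rule finite_borel_measure_jordan[OF jd])
  interpret n: finite_borel_measure \<nu> by (rule finite_borel_measure_jordan[OF jd])
  have [measurable]: "v \<in> borel_measurable borel" "\<psi> \<in> borel_measurable borel"
    using v cont by (auto intro: borel_measurable_continuous_onI)
  have "compact (\<psi> ` {c..d})"
    by (intro compact_continuous_image continuous_on_subset[OF cont]) auto
  then obtain B where "0 < B" and B: "\<And>x. x \<in> {c..d} \<Longrightarrow> \<bar>\<psi> x\<bar> \<le> B"
    using compact_imp_bounded[of "\<psi> ` {c..d}"] by (auto simp: bounded_pos)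
  have B: "\<bar>\<psi> x\<bar> \<le> B" for x
    using B[of x] \<psi>0[of x] \<open>0 < B\<close> by (cases "x \<in> {c<..<d}") auto
  have test: "test_function \<phi>"
  proof -
    have "\<phi> C1_differentiable_on UNIV"
      unfolding C1_differentiable_on_def
      using deriv cont by (auto simp flip: has_real_derivative_iff_has_vector_derivative)
    moreover have "{x. \<phi> x \<noteq> 0} \<subseteq> {c..d}"
    proof
      fix x assume "x \<in> {x. \<phi> x \<noteq> 0}"
      then have "x \<in> {c<..<d}" using \<phi>0[of x] by blast
      then show "x \<in> {c..d}" by simp
    qed
    then have "compact (closure {x. \<phi> x \<noteq> 0})"
      by (meson bounded_closed_interval bounded_subset compact_closure)
    ultimately show ?thesis by (simp add: test_function_def)
  qed
  have dphi: "deriv \<phi> = \<psi>" using deriv DERIV_imp_deriv by blast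
  have eq: "(LINT x|lebesgue. u x * \<psi> x) = - ((LINT x|\<mu>. \<phi> x) - (LINT x|\<nu>. \<phi> x))"
    using jd test unfolding is_jordan_derivative_def dphi[symmetric] by blast
  have "(LINT x|lebesgue. u x * \<psi> x) = (LINT x|lebesgue. v x * \<psi> x)"
  proof (rule integral_cong_AE)
    have *: "(\<lambda>x. v x * \<psi> x) \<in> borel_measurable lebesgue"
      by (intro measurable_completion) simp
    then show "(\<lambda>x. v x * \<psi> x) \<in> borel_measurable lebesgue" .
    show ae: "AE x in lebesgue. u x * \<psi> x = v x * \<psi> x"
      using uv by eventually_elim auto
    show "(\<lambda>x. u x * \<psi> x) \<in> borel_measurable lebesgue"
      by (intro borel_measurable_times u measurable_completion) simp
  qed
  also have "\<dots> = (LINT x|lborel. v x * \<psi> x)"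
    by (rule integral_completion) simp
  finally have eq': "(LINT x|lborel. v x * \<psi> x) = - ((LINT x|\<mu>. \<phi> x) - (LINT x|\<nu>. \<phi> x))"
    using eq by simp
  have iv: "integrable lborel (\<lambda>x. v x * \<psi> x)"
    by (rule Bochner_Integration.integrable_bound[where f = "\<lambda>x. B * v x"])
      (use v B in \<open>auto simp: abs_mult mult.commute
        intro!: AE_I2 mult_right_mono order_trans[OF B abs_ge_self]\<close>)
  note im = m.integral_deriv_mult_cdf[OF deriv cont \<phi>0 \<psi>0]
  note iN = n.integral_deriv_mult_cdf[OF deriv cont \<phi>0 \<psi>0]
  have split: "(\<lambda>r. (v r - (cdf \<mu> r - cdf \<nu> r)) * \<psi> r) =
      (\<lambda>r. v r * \<psi> r - (\<psi> r * cdf \<mu> r - \<psi> r * cdf \<nu> r))"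
    by (auto simp: algebra_simps)
  show "integrable lborel (\<lambda>r. (v r - (cdf \<mu> r - cdf \<nu> r)) * \<psi> r)"
    unfolding split using iv im(1) iN(1) by simp
  show "(LINT r|lborel. (v r - (cdf \<mu> r - cdf \<nu> r)) * \<psi> r) = 0"
    unfolding split using iv im iN eq' by simp
qed

text \<open>
  The test function is \<open>\<Psi> - \<Psi>(\<cdot> + n)\<close> for an antiderivative \<open>\<Psi>\<close> of \<open>\<psi>\<close>; the translated term
  drops out as \<open>n \<rightarrow> \<infinity>\<close> because \<open>v\<close> vanishes and the distribution functions are small far to the left.
\<close>

lemma integral_against_continuous_eq_zero:
  fixes u \<psi> :: "real \<Rightarrow> real"
  assumes jd: "is_jordan_derivative u \<mu> \<nu>" and u: "u \<in> borel_measurable lebesgue"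
    and v: "integrable lborel v" and uv: "AE r in lebesgue. u r = v r"
    and left: "AE r in lborel. r < R \<longrightarrow> v r = 0"
    and cont: "continuous_on UNIV \<psi>" and bnd: "\<And>x. \<bar>\<psi> x\<bar> \<le> 1"
    and \<psi>0: "\<And>x. x \<notin> {c<..<d} \<Longrightarrow> \<psi> x = 0" and "c < d"
  shows "(LINT r|lborel. (v r - (cdf \<mu> r - cdf \<nu> r)) * \<psi> r) = 0"
proof -
  interpret m: finite_borel_measure \<mu> by (rule finite_borel_measure_jordan[OF jd])
  interpret n: finite_borel_measure \<nu> by (rule finite_borel_measure_jordan[OF jd])
  define g where "g r = v r - (cdf \<mu> r - cdf \<nu> r)" for r
  have [measurable]: "cdf \<mu> \<in> borel_measurable borel" "cdf \<nu> \<in> borel_measurable borel"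
    by (intro borel_measurable_mono monoI m.cdf_nondecreasing n.cdf_nondecreasing; assumption)+
  have [measurable]: "v \<in> borel_measurable borel" "\<psi> \<in> borel_measurable borel"
    using v cont by (auto intro: borel_measurable_continuous_onI)
  have g_meas[measurable]: "g \<in> borel_measurable borel" unfolding g_def by simp
  obtain \<Psi> where \<Psi>: "\<And>x. (\<Psi> has_real_derivative \<psi> x) (at x)"
    using einterval_antiderivative[of "-\<infinity>" \<infinity> \<psi>] cont
    by (auto simp: has_real_derivative_iff_has_vector_derivative continuous_on_eq_continuous_at)
  have const: "\<Psi> x = \<Psi> y" if "\<And>z. z \<in> {x..y} \<Longrightarrow> \<psi> z = 0" "x \<le> y" for x y
  proof (cases "x = y")
    case False
    then show ?thesis
      using that DERIV_isconst_end[of x y \<Psi>] \<Psi>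
      by (metis DERIV_isCont atLeastAtMost_iff continuous_at_imp_continuous_on less_eq_real_def)
  qed auto
  have int_ind: "integrable lborel (\<lambda>r. g r * indicator {a..b} r)" for a b
  proof (rule Bochner_Integration.integrable_bound)
    let ?K = "measure \<mu> (space \<mu>) + measure \<nu> (space \<nu>)"
    show "integrable lborel (\<lambda>r. \<bar>v r\<bar> + ?K * indicator {a..b} r)"
      using v by (intro Bochner_Integration.integrable_add integrable_mult_right integrable_real_indicator)
        (auto intro!: emeasure_bounded_finite simp flip: infinity_ennreal_def)
    have "\<bar>g r\<bar> \<le> \<bar>v r\<bar> + ?K" for r
      using m.cdf_bounded[of r] n.cdf_bounded[of r] m.cdf_nonneg[of r] n.cdf_nonneg[of r]
      unfolding g_def by linarith
    then show "AE r in lborel. norm (g r * indicator {a..b} r) \<le> norm (\<bar>v r\<bar> + ?K * indicator {a..b} r)"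
      by (intro AE_I2) (auto simp: indicator_def intro: order_trans[OF _ abs_ge_self])
  qed simp
  have int_psi: "integrable lborel (\<lambda>r. g r * \<psi> (r + t))" for t
  proof (rule Bochner_Integration.integrable_bound[OF int_ind[of "c - t" "d - t"]])
    show "AE r in lborel. norm (g r * \<psi> (r + t)) \<le> norm (g r * indicator {c - t..d - t} r)"
    proof (intro AE_I2)
      fix r show "norm (g r * \<psi> (r + t)) \<le> norm (g r * indicator {c - t..d - t} r)"
        using bnd[of "r + t"] \<psi>0[of "r + t"]
        by (cases "r + t \<in> {c<..<d}") (auto simp: indicator_def abs_mult mult_left_le)
    qed
  qed simp
  have shift: "(LINT r|lborel. g r * \<psi> r) = (LINT r|lborel. g r * \<psi> (r + real k))" for k
  proof -
    have "(LINT r|lborel. (v r - (cdf \<mu> r - cdf \<nu> r)) * (\<psi> r - \<psi> (r + real k))) = 0"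
    proof (rule test_integral_representation(2)[OF jd u v uv, where \<phi> = "\<lambda>x. \<Psi> x - \<Psi> (x + real k)"
          and c = "c - real k" and d = d])
      show "((\<lambda>x. \<Psi> x - \<Psi> (x + real k)) has_real_derivative \<psi> x - \<psi> (x + real k)) (at x)" for x
        by (auto intro!: derivative_eq_intros \<Psi> DERIV_chain2[OF \<Psi>])
      show "continuous_on UNIV (\<lambda>x. \<psi> x - \<psi> (x + real k))"
        by (intro continuous_intros continuous_on_compose2[OF cont]) auto
    next
      fix x assume "x \<notin> {c - real k<..<d}"
      \<comment> \<open>Either \<open>x \<ge> d\<close> or \<open>x + k \<le> c\<close>, so
        \<open>\<psi>\<close> vanishes on all of \<open>{x..x + real k}\<close> and the
        antiderivative takes equal values at both ends.\<close>
      then have *: "\<forall>z \<in> {x..x + real k}. z \<notin> {c<..<d}" by auto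
      show "\<Psi> x - \<Psi> (x + real k) = 0" using const[of x "x + real k"] \<psi>0 * by auto
      show "\<psi> x - \<psi> (x + real k) = 0" using \<psi>0 * by auto
    qed
    then have "(LINT r|lborel. g r * \<psi> r - g r * \<psi> (r + real k)) = 0"
      by (simp add: g_def algebra_simps)
    then show ?thesis
      using int_psi[of 0] int_psi[of "real k"] by simp
  qed
  have "(\<lambda>k. LINT r|lborel. g r * \<psi> (r + real k)) \<longlonglongrightarrow> 0"
  proof (rule Lim_null_comparison)
    let ?G = "\<lambda>k. cdf \<mu> (d - real k) + cdf \<nu> (d - real k)"
    \<comment> \<open>From here on the support of \<open>\<psi>\<close> translated by
      \<open>k\<close> lies left of \<open>R\<close>, where \<open>v = 0\<close>, so only the
      distribution functions contribute to \<open>g\<close>.\<close>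
    have "eventually (\<lambda>k. real k > d - R) sequentially"
      by real_asymp
    then show "\<forall>\<^sub>F k in sequentially. norm (LINT r|lborel. g r * \<psi> (r + real k)) \<le> (d - c) * ?G k"
    proof eventually_elim
      case (elim k)
      have ae: "AE r in lborel. norm (g r * \<psi> (r + real k)) \<le> ?G k * indicator {c - real k..d - real k} r"
        using left
      proof eventually_elim
        case (elim r)
        show ?case
        proof (cases "r + real k \<in> {c<..<d}")
          case True
          then have "r < R" "r \<le> d - real k" using \<open>d - R < real k\<close> by auto
          then have "\<bar>g r\<bar> \<le> ?G k"
            using elim m.cdf_nondecreasing[of r "d - real k"] n.cdf_nondecreasing[of r "d - real k"]
              m.cdf_nonneg[of r] n.cdf_nonneg[of r] by (simp add: g_def)
          then have "\<bar>g r\<bar> * \<bar>\<psi> (r + real k)\<bar> \<le> ?G k * 1"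
            by (intro mult_mono bnd) auto
          then show ?thesis using True by (auto simp: abs_mult indicator_def)
        next
          case False
          then show ?thesis using \<psi>0 m.cdf_nonneg n.cdf_nonneg by (simp add: indicator_def)
        qed
      qed
      have "norm (LINT r|lborel. g r * \<psi> (r + real k)) \<le> (LINT r|lborel. norm (g r * \<psi> (r + real k)))"
        by (rule integral_norm_bound)
      also have "\<dots> \<le> (LINT r|lborel. ?G k * indicator {c - real k..d - real k} r)"
        using int_psi ae
        by (intro integral_mono_AE integrable_mult_right integrable_real_indicator)
          (auto intro!: emeasure_bounded_finite simp flip: infinity_ennreal_def)
      also have "\<dots> = (d - c) * ?G k" using \<open>c < d\<close> by simp
      finally show ?case .
    qed
    have "filterlim (\<lambda>k. d - real k) at_bot sequentially" by real_asymp
    from filterlim_compose[OF m.cdf_lim_at_bot this] filterlim_compose[OF n.cdf_lim_at_bot this]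
    have "(\<lambda>k. (d - c) * ?G k) \<longlonglongrightarrow> (d - c) * (0 + 0)"
      by (intro tendsto_intros)
    then show "(\<lambda>k. (d - c) * ?G k) \<longlonglongrightarrow> 0" by simp
  qed
  \<comment> \<open>By \<open>shift\<close> the sequence is constant, so its limit 0 is its
    value.\<close>
  then have "(\<lambda>k::nat. LINT r|lborel. g r * \<psi> r) \<longlonglongrightarrow> 0"
    by (simp only: shift[symmetric])
  then show ?thesis by (simp add: LIMSEQ_const_iff g_def)
qed

text \<open>Equal distributional derivatives determine a function up to a constant. The constant is
  0 because \<open>u\<close> vanishes far to the left and both distribution functions tend to 0
  there. The identity passes from continuous tests to intervals, then to almost every point.\<close>

lemma eq_cdf_diff:
  assumes jd: "is_jordan_derivative u \<mu> \<nu>" and u: "integrable lebesgue u"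
    and left: "AE r in lebesgue. r < R \<longrightarrow> u r = 0"
  shows "AE r in lebesgue. u r = cdf \<mu> r - cdf \<nu> r"
proof -
  interpret m: finite_borel_measure \<mu> by (rule finite_borel_measure_jordan[OF jd])
  interpret n: finite_borel_measure \<nu> by (rule finite_borel_measure_jordan[OF jd])
  obtain v where [measurable]: "v \<in> borel_measurable lborel" and uv: "AE r in lborel. u r = v r"
    using completion_ex_borel_measurable_real[of u lborel] u by auto
  have uv': "AE r in lebesgue. u r = v r" using uv by (rule AE_completion)
  have v: "integrable lborel v"
  proof -
    have "integrable lebesgue v"
      by (rule integrable_cong_AE_imp[OF u]) (use uv' in \<open>auto intro: measurable_completion\<close>)
    then show ?thesis by (simp add: integrable_completion)
  qed
  have left': "AE r in lborel. r < R \<longrightarrow> v r = 0"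
  proof -
    have "AE r in lborel. r < R \<longrightarrow> u r = 0" using left by (simp add: AE_completion_iff)
    with uv show ?thesis by eventually_elim auto
  qed
  define g where "g r = v r - (cdf \<mu> r - cdf \<nu> r)" for r
  have [measurable]: "cdf \<mu> \<in> borel_measurable borel" "cdf \<nu> \<in> borel_measurable borel"
    by (intro borel_measurable_mono monoI m.cdf_nondecreasing n.cdf_nondecreasing; assumption)+
  have [measurable]: "g \<in> borel_measurable borel" unfolding g_def by simp
  have int_ind: "integrable lborel (\<lambda>r. g r * indicator {a<..<b} r)" for a b
  proof (rule Bochner_Integration.integrable_bound)
    let ?K = "measure \<mu> (space \<mu>) + measure \<nu> (space \<nu>)"
    show "integrable lborel (\<lambda>r. \<bar>v r\<bar> + ?K * indicator {a<..<b} r)"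
      using v by (intro Bochner_Integration.integrable_add integrable_mult_right integrable_real_indicator)
        (auto intro!: emeasure_bounded_finite simp flip: infinity_ennreal_def)
    have "\<bar>g r\<bar> \<le> \<bar>v r\<bar> + ?K" for r
      using m.cdf_bounded[of r] n.cdf_bounded[of r] m.cdf_nonneg[of r] n.cdf_nonneg[of r]
      unfolding g_def by linarith
    then show "AE r in lborel. norm (g r * indicator {a<..<b} r) \<le> norm (\<bar>v r\<bar> + ?K * indicator {a<..<b} r)"
      by (intro AE_I2) (auto simp: indicator_def intro: order_trans[OF _ abs_ge_self])
  qed simp
  have ioo: "(LINT r|lborel. g r * indicator {a<..<b} r) = 0" for a b
  proof (cases "a < b")
    case True
    \<comment> \<open>Continuous trapezoids that increase to the indicator of the open interval and
      stay below it, so dominated convergence applies.\<close>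
    define h where "h k x = min 1 (real k * max 0 (min (x - a) (b - x)))" for k x
    have h0: "h k x = 0" if "x \<notin> {a<..<b}" for k x using that by (auto simp: h_def)
    have h1: "0 \<le> h k x" "h k x \<le> 1" for k x by (auto simp: h_def)
    have hcont: "continuous_on UNIV (h k)" for k unfolding h_def by (intro continuous_intros)
    have [measurable]: "h k \<in> borel_measurable borel" for k
      using hcont by (rule borel_measurable_continuous_onI)
    have "(\<lambda>k. LINT r|lborel. g r * h k r) \<longlonglongrightarrow> (LINT r|lborel. g r * indicator {a<..<b} r)"
    proof (rule integral_dominated_convergence[where w = "\<lambda>r. \<bar>g r * indicator {a<..<b} r\<bar>"])
      show "AE r in lborel. (\<lambda>k. g r * h k r) \<longlonglongrightarrow> g r * indicator {a<..<b} r"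
      proof (intro AE_I2 tendsto_mult tendsto_const)
        fix x show "(\<lambda>k. h k x) \<longlonglongrightarrow> indicator {a<..<b} x"
        proof (cases "x \<in> {a<..<b}")
          case True
          then have pos: "0 < min (x - a) (b - x)" (is "0 < ?e") by auto
          then have "eventually (\<lambda>k. 1 \<le> real k * ?e) sequentially" by real_asymp
          then have "eventually (\<lambda>k. h k x = 1) sequentially"
            by eventually_elim (use pos in \<open>auto simp: h_def max_def\<close>)
          then show ?thesis using True by (simp add: tendsto_eventually)
        qed (simp add: h0)
      qed
      show "AE r in lborel. norm (g r * h k r) \<le> \<bar>g r * indicator {a<..<b} r\<bar>" for k
      proof (intro AE_I2)
        fix r show "norm (g r * h k r) \<le> \<bar>g r * indicator {a<..<b} r\<bar>"
          using h1[of k r] h0[of r k]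
          by (cases "r \<in> {a<..<b}") (auto simp: indicator_def abs_mult mult_left_le)
      qed
    qed (use int_ind in auto)
    moreover have "(LINT r|lborel. g r * h k r) = 0" for k
      unfolding g_def
      by (rule integral_against_continuous_eq_zero[OF jd borel_measurable_integrable[OF u] v uv' left' hcont _ _ True])
        (use h0 h1 in auto)
    ultimately show ?thesis by (simp add: LIMSEQ_const_iff)
  qed simp
  \<comment> \<open>\<open>g\<close> is so far known to be integrable only on bounded intervals; it
    is therefore cut off to \<open>(-k, k)\<close> and the countably many null sets are
    joined.\<close>
  have "AE r in lborel. g r * indicator {- real k<..<real k} r = 0" for k
  proof (rule AE_zero_if_tail_integrals_zero[OF int_ind])
    fix x
    have "(\<lambda>r. g r * indicator {- real k<..<real k} r * indicator {x<..} r)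
        = (\<lambda>r. g r * indicator {max x (- real k)<..<real k} r)"
      by (auto simp: indicator_def)
    then show "(LINT r|lborel. g r * indicator {- real k<..<real k} r * indicator {x<..} r) = 0"
      using ioo by simp
  qed
  then have "AE r in lborel. \<forall>k. g r * indicator {- real k<..<real k} r = 0"
    by (subst AE_all_countable) blast
  then have "AE r in lborel. v r = cdf \<mu> r - cdf \<nu> r"
  proof eventually_elim
    case (elim r)
    obtain k where "\<bar>r\<bar> < real k" using reals_Archimedean2 by blast
    then have "r \<in> {- real k<..<real k}" by auto
    with elim[rule_format, of k] show ?case by (simp add: g_def)
  qed
  then have "AE r in lebesgue. v r = cdf \<mu> r - cdf \<nu> r" by (rule AE_completion)
  with uv' show ?thesis by eventually_elim simp
qed

section \<open>Auxiliary facts on Lebesgue measure and on mutually singular measures\<close>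

lemma AE_lborel_ex_between:
  fixes a b :: real
  assumes ae: "AE x in lborel. P x" and "a < b"
  shows "\<exists>x. a < x \<and> x < b \<and> P x"
proof (rule ccontr)
  assume "\<not> ?thesis"
  then have "AE x in lborel. x \<notin> {a<..<b}" using ae by (auto elim: eventually_mono)
  then have "emeasure lborel {a<..<b} = 0"
    by (subst (asm) AE_iff_measurable[where N = "{a<..<b}"]) auto
  then show False using \<open>a < b\<close> by simp
qed

lemma LBINT_power2_Icc:
  fixes x y :: real
  assumes "x \<le> y"
  shows "(LBINT r. r\<^sup>2 * indicator {x..y} r) = (y ^ 3 - x ^ 3) / 3"
proof -
  have "(LBINT r. r\<^sup>2 * indicator {x..y} r) = y ^ 3 / 3 - x ^ 3 / 3"
    by (rule integral_FTC_Icc_real)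
      (use assms in \<open>auto intro!: derivative_eq_intros continuous_intros\<close>)
  then show ?thesis by (simp add: diff_divide_distrib)
qed

text \<open>Agreement on half-lines cut with \<open>B\<close> makes the two measures agree on every
  Borel subset of \<open>B\<close>. Then \<open>\<nu> S = 0\<close> forces \<open>\<mu>\<close> to
  vanish on \<open>S \<inter> B\<close>, while \<open>\<mu>\<close> vanishes off \<open>S\<close>
  anyway.\<close>

lemma singular_measures_null:
  fixes \<mu> \<nu> :: "real measure"
  assumes sets: "sets \<mu> = sets borel" "sets \<nu> = sets borel"
    and fin: "finite_measure \<mu>" "finite_measure \<nu>"
    and S: "S \<in> sets borel" "emeasure \<mu> (- S) = 0" "emeasure \<nu> S = 0"
    and B: "B \<in> sets borel"
    and eq: "\<And>x. measure \<mu> ({x<..} \<inter> B) = measure \<nu> ({x<..} \<inter> B)"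
  shows "B \<in> null_sets \<mu>" "B \<in> null_sets \<nu>"
proof -
  interpret m: finite_measure \<mu> by fact
  interpret n: finite_measure \<nu> by fact
  have *: "emeasure (density \<mu> (indicator B)) X = emeasure \<mu> (X \<inter> B)"
    "emeasure (density \<nu> (indicator B)) X = emeasure \<nu> (X \<inter> B)" if "X \<in> sets borel" for X
    using that B sets by (auto simp: emeasure_restricted Int_commute)
  have "density \<mu> (indicator B) = density \<nu> (indicator B)"
    by (rule measure_eqI_lessThan)
      (simp_all add: sets * m.emeasure_eq_measure n.emeasure_eq_measure eq ennreal_less_top)
  then have inter: "emeasure \<mu> (X \<inter> B) = emeasure \<nu> (X \<inter> B)" if "X \<in> sets borel" for X
    using * that by metis
  have "emeasure \<nu> (S \<inter> B) = 0"
    using S B sets emeasure_mono[of "S \<inter> B" S \<nu>] by auto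
  then have "emeasure \<mu> (S \<inter> B) = 0" using inter S by simp
  moreover have "emeasure \<mu> (- S \<inter> B) = 0"
    using S B sets emeasure_mono[of "- S \<inter> B" "- S" \<mu>] by auto
  moreover have "B = (S \<inter> B) \<union> (- S \<inter> B)" by auto
  ultimately have "emeasure \<mu> B = 0"
    using emeasure_subadditive[of "S \<inter> B" \<mu> "- S \<inter> B"] S B sets by auto
  moreover from this have "emeasure \<nu> B = 0" using inter[of UNIV] by simp
  ultimately show "B \<in> null_sets \<mu>" "B \<in> null_sets \<nu>"
    using B sets by (auto simp: null_sets_def)
qed

section \<open>Admissible functions\<close>

locale admissible =
  fixes R1 R2 :: real and u :: "real \<Rightarrow> real"
  assumes R1_pos: "0 < R1" and R1_less_R2: "R1 < R2" and u_in: "u \<in> A_BV R1 R2"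
begin

abbreviation \<mu> :: "real measure" where "\<mu> \<equiv> Du_pos u"
abbreviation \<nu> :: "real measure" where "\<nu> \<equiv> Du_neg u"

text \<open>Membership in \<open>BV\<close> provides a Jordan pair, so the choice operator behind
  \<open>Du_pos\<close> and \<open>Du_neg\<close> returns one.\<close>

lemma jordan: "is_jordan_derivative u \<mu> \<nu>"
proof -
  obtain m n where "is_jordan_derivative u m n" using u_in by (auto simp: A_BV_def BV_def)
  then have "case (m, n) of (m, n) \<Rightarrow> is_jordan_derivative u m n" by simp
  from someI[where P = "\<lambda>(m, n). is_jordan_derivative u m n", OF this]
  show ?thesis
    unfolding Du_pos_def Du_neg_def jordan_derivative_def by (simp add: case_prod_unfold)
qed

sublocale m: finite_borel_measure \<mu>
  by (rule finite_borel_measure_jordan[OF jordan])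

sublocale n: finite_borel_measure \<nu>
  by (rule finite_borel_measure_jordan[OF jordan])

declare m.M_is_borel[measurable_cong] n.M_is_borel[measurable_cong]

lemma cdf_measurable[measurable]:
  "cdf \<mu> \<in> borel_measurable borel" "cdf \<nu> \<in> borel_measurable borel"
  by (intro borel_measurable_mono monoI m.cdf_nondecreasing n.cdf_nondecreasing; assumption)+

lemma u_integrable: "integrable lebesgue u"
  and u_nonneg: "AE r in lebesgue. 0 \<le> u r"
  and u_outside: "AE r in lebesgue. r \<notin> {R1..R2} \<longrightarrow> u r = 0"
  and u_mass: "(LINT r:{R1..R2}|lebesgue. r\<^sup>2 * u r) = 1"
  using u_in by (auto simp: A_BV_def BV_def)

lemma u_eq_cdf: "AE r in lebesgue. u r = cdf \<mu> r - cdf \<nu> r"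
proof (rule eq_cdf_diff[OF jordan u_integrable])
  show "AE r in lebesgue. r < R1 \<longrightarrow> u r = 0"
    using u_outside by eventually_elim auto
qed

text \<open>The equality holds a.e. outside the interval because \<open>u\<close> vanishes there;
  right continuity makes it hold at each point. Hence \<open>R2\<close> is included but
  \<open>R1\<close> is not: an upward jump of \<open>u\<close> at \<open>R1\<close> already shows in
  \<open>cdf \<mu> R1\<close>.\<close>

lemma cdf_eq:
  assumes "r < R1 \<or> R2 \<le> r"
  shows "cdf \<mu> r = cdf \<nu> r"
proof (rule ccontr)
  assume ne: "cdf \<mu> r \<noteq> cdf \<nu> r"
  have ae: "AE r in lborel. r \<notin> {R1..R2} \<longrightarrow> cdf \<mu> r = cdf \<nu> r"
  proof -
    have "AE r in lebesgue. r \<notin> {R1..R2} \<longrightarrow> cdf \<mu> r = cdf \<nu> r"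
      using u_outside u_eq_cdf by eventually_elim auto
    then show ?thesis by (simp add: AE_completion_iff)
  qed
  have "((\<lambda>x. cdf \<mu> x - cdf \<nu> x) \<longlongrightarrow> cdf \<mu> r - cdf \<nu> r) (at_right r)"
    using m.cdf_is_right_cont[of r] n.cdf_is_right_cont[of r]
    by (intro tendsto_diff) (auto simp: continuous_within)
  from tendsto_imp_eventually_ne[OF this, of 0] ne
  obtain b where b: "r < b" "\<And>y. r < y \<Longrightarrow> y < b \<Longrightarrow> cdf \<mu> y \<noteq> cdf \<nu> y"
    unfolding eventually_at_right[OF less_add_one] by auto
  \<comment> \<open>Cutting at \<open>R1\<close> keeps the right neighbourhood of \<open>r\<close>
    outside \<open>{R1..R2}\<close>.\<close>
  define c where "c = (if r < R1 then min b R1 else b)"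
  have "r < c" using b by (auto simp: c_def)
  from AE_lborel_ex_between[OF ae this] obtain y where "r < y" "y < c"
    and y: "y \<notin> {R1..R2} \<longrightarrow> cdf \<mu> y = cdf \<nu> y" by blast
  then have "y < b" "y \<notin> {R1..R2}" using assms by (auto simp: c_def split: if_splits)
  then show False using y b(2) \<open>r < y\<close> by auto
qed

lemma total_mass_eq: "measure \<mu> UNIV = measure \<nu> UNIV"
proof -
  have "eventually (\<lambda>r. cdf \<mu> r = cdf \<nu> r) at_top"
    using eventually_ge_at_top[of R2] by eventually_elim (simp add: cdf_eq)
  with m.cdf_lim_at_top have "(cdf \<nu> \<longlongrightarrow> measure \<mu> (space \<mu>)) at_top"
    by (rule Lim_transform_eventually)
  from tendsto_unique[OF trivial_limit_at_top_linorder this n.cdf_lim_at_top]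
  show ?thesis by (simp only: m.borel_UNIV n.borel_UNIV)
qed

lemma measure_greaterThan:
  "measure \<mu> {x<..} = measure \<mu> UNIV - cdf \<mu> x" "measure \<nu> {x<..} = measure \<nu> UNIV - cdf \<nu> x"
proof -
  have *: "UNIV - {..x} = {x<..}" by auto
  show "measure \<mu> {x<..} = measure \<mu> UNIV - cdf \<mu> x"
    using m.finite_measure_compl[of "{..x}"] by (simp add: * m.M_is_borel m.borel_UNIV cdf_def)
  show "measure \<nu> {x<..} = measure \<nu> UNIV - cdf \<nu> x"
    using n.finite_measure_compl[of "{..x}"] by (simp add: * n.M_is_borel n.borel_UNIV cdf_def)
qed

text \<open>Outside the interval the distribution functions agree, so the two measures agree on
  half-lines there, and mutual singularity makes both of them null.\<close>

lemma AE_in_interval: "AE x in \<mu>. x \<in> {R1..R2}" "AE x in \<nu>. x \<in> {R1..R2}"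
proof -
  obtain S where S: "S \<in> sets borel" "emeasure \<mu> (- S) = 0" "emeasure \<nu> S = 0"
    using jordan by (auto simp: is_jordan_derivative_def)
  note sing = singular_measures_null[OF m.M_is_borel n.M_is_borel m.finite_measure_axioms
      n.finite_measure_axioms S]
  have right: "{R2<..} \<in> null_sets \<mu>" "{R2<..} \<in> null_sets \<nu>"
  proof -
    have "measure \<mu> ({x<..} \<inter> {R2<..}) = measure \<nu> ({x<..} \<inter> {R2<..})" for x
      by (simp add: lessThan_Int_lessThan measure_greaterThan total_mass_eq cdf_eq)
    then show "{R2<..} \<in> null_sets \<mu>" "{R2<..} \<in> null_sets \<nu>" using sing by auto
  qed
  have left: "{..c} \<in> null_sets \<mu>" "{..c} \<in> null_sets \<nu>" if "c < R1" for c
  proof -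
    have "measure \<mu> ({x<..} \<inter> {..c}) = measure \<nu> ({x<..} \<inter> {..c})" for x
    proof (cases "x < c")
      case True
      moreover have "{x<..} \<inter> {..c} = {x<..c}" by auto
      ultimately show ?thesis
        using that by (simp add: m.cdf_diff_eq[symmetric] n.cdf_diff_eq[symmetric] cdf_eq)
    next
      case False
      then have "{x<..} \<inter> {..c} = {}" by auto
      then show ?thesis by simp
    qed
    then show "{..c} \<in> null_sets \<mu>" "{..c} \<in> null_sets \<nu>" using sing by auto
  qed
  have "AE x in M. x \<in> {R1..R2}"
    if 1: "{R2<..} \<in> null_sets M" and 2: "\<And>c. c < R1 \<Longrightarrow> {..c} \<in> null_sets M" for M :: "real measure"
  proof -
    \<comment> \<open>\<open>cdf_eq\<close> covers only points strictly left of \<open>R1\<close>,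
      so \<open>{..<R1}\<close> is exhausted by countably many closed half-lines.\<close>
    have "AE x in M. \<forall>k. x \<notin> {..R1 - inverse (real (Suc k))}"
      unfolding AE_all_countable by (intro allI AE_not_in 2) simp
    with AE_not_in[OF 1] show ?thesis
    proof eventually_elim
      case (elim x)
      have "\<not> x < R1"
      proof
        assume "x < R1"
        then obtain k where "inverse (real (Suc k)) < R1 - x"
          using reals_Archimedean[of "R1 - x"] by auto
        then show False using elim(2)[rule_format, of k] by auto
      qed
      then show ?case using elim by auto
    qed
  qed
  then show "AE x in \<mu>. x \<in> {R1..R2}" "AE x in \<nu>. x \<in> {R1..R2}" using left right by auto
qed

lemma integrable_bounded:
  fixes f :: "real \<Rightarrow> real"
  assumes "f \<in> borel_measurable borel" and "\<And>x. x \<in> {R1..R2} \<Longrightarrow> \<bar>f x\<bar> \<le> B"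
  shows "integrable \<mu> f" "integrable \<nu> f"
proof -
  have "AE x in \<mu>. norm (f x) \<le> B"
    using AE_in_interval(1) by eventually_elim (use assms in auto)
  moreover have "AE x in \<nu>. norm (f x) \<le> B"
    using AE_in_interval(2) by eventually_elim (use assms in auto)
  moreover have "f \<in> borel_measurable \<mu>" "f \<in> borel_measurable \<nu>"
    using assms(1) by auto
  ultimately show "integrable \<mu> f" "integrable \<nu> f"
    using m.integrable_const_bound[of f B] n.integrable_const_bound[of f B] by blast+
qed

lemma integrable_continuous:
  fixes f :: "real \<Rightarrow> real"
  assumes "continuous_on UNIV f"
  shows "integrable \<mu> f" "integrable \<nu> f"
proof -
  have "compact (f ` {R1..R2})"
    by (intro compact_continuous_image continuous_on_subset[OF assms]) auto
  then obtain B where "\<forall>y \<in> f ` {R1..R2}. norm y \<le> B"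
    using compact_imp_bounded[of "f ` {R1..R2}"] by (auto simp: bounded_iff)
  then have B: "\<bar>f x\<bar> \<le> B" if "x \<in> {R1..R2}" for x using that by auto
  show "integrable \<mu> f" "integrable \<nu> f"
    by (rule integrable_bounded[OF borel_measurable_continuous_onI[OF assms] B]; assumption)+
qed

lemma lebesgue_integral_u:
  assumes f: "f \<in> borel_measurable borel" and int: "integrable lborel f"
  shows "(LINT r|lebesgue. f r * u r) =
    (LINT x|\<mu>. (LBINT r. f r * indicator {x..} r)) - (LINT x|\<nu>. (LBINT r. f r * indicator {x..} r))"
proof -
  have "(LINT r|lebesgue. f r * u r) = (LINT r|lebesgue. f r * (cdf \<mu> r - cdf \<nu> r))"
  proof (rule integral_cong_AE)
    show "AE r in lebesgue. f r * u r = f r * (cdf \<mu> r - cdf \<nu> r)"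
      using u_eq_cdf by eventually_elim simp
    show "(\<lambda>r. f r * u r) \<in> borel_measurable lebesgue"
      by (intro borel_measurable_times borel_measurable_integrable[OF u_integrable] measurable_completion)
        (use f in simp)
    show "(\<lambda>r. f r * (cdf \<mu> r - cdf \<nu> r)) \<in> borel_measurable lebesgue"
      using f by (intro measurable_completion) simp
  qed
  also have "\<dots> = (LBINT r. f r * (cdf \<mu> r - cdf \<nu> r))"
    using f by (intro integral_completion) simp
  also have "\<dots> = (LBINT r. f r * cdf \<mu> r) - (LBINT r. f r * cdf \<nu> r)"
    using m.integrable_mult_cdf[OF int] n.integrable_mult_cdf[OF int]
    by (simp add: right_diff_distrib)
  finally show ?thesis by (simp add: m.integral_mult_cdf[OF int] n.integral_mult_cdf[OF int])
qed

text \<open>Fubini applied to \<open>r^2\<close> on \<open>{R1..R2}\<close>, whose tail integral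
  from \<open>x\<close> is \<open>A_fun R2 x\<close> for \<open>x\<close> in the interval that
  carries both measures.\<close>

lemma mass_identity: "(LINT x|\<mu>. A_fun R2 x) - (LINT x|\<nu>. A_fun R2 x) = 1"
proof -
  let ?f = "\<lambda>r. r\<^sup>2 * indicator {R1..R2} r"
  have int: "integrable lborel ?f"
  proof -
    have "continuous_on {R1..R2} (\<lambda>r::real. r\<^sup>2)" by (intro continuous_intros)
    from borel_integrable_atLeastAtMost'[OF this] show ?thesis
      by (simp add: set_integrable_def mult.commute)
  qed
  \<comment> \<open>Clamping \<open>x\<close> to the interval makes the formula valid for every real
    \<open>x\<close>; the clamp is removed a.e. afterwards.\<close>
  have inner: "(LBINT r. ?f r * indicator {x..} r) = A_fun R2 (min R2 (max R1 x))" for x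
  proof (cases "x \<le> R2")
    case True
    then have "(\<lambda>r. ?f r * indicator {x..} r) = (\<lambda>r. r\<^sup>2 * indicator {max R1 x..R2} r)"
      by (auto simp: indicator_def)
    then show ?thesis using True R1_less_R2 by (simp add: LBINT_power2_Icc A_fun_def)
  next
    case False
    then have "(\<lambda>r. ?f r * indicator {x..} r) = (\<lambda>r. 0)"
      by (auto simp: indicator_def)
    then show ?thesis using False by (simp add: A_fun_def)
  qed
  have "1 = (LINT r|lebesgue. ?f r * u r)"
    unfolding u_mass[symmetric] set_lebesgue_integral_def by (simp add: ac_simps)
  also have "\<dots> = (LINT x|\<mu>. (LBINT r. ?f r * indicator {x..} r)) - (LINT x|\<nu>. (LBINT r. ?f r * indicator {x..} r))"
    by (rule lebesgue_integral_u[OF _ int]) simp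
  also have "(LINT x|\<mu>. (LBINT r. ?f r * indicator {x..} r)) = (LINT x|\<mu>. A_fun R2 x)"
    unfolding inner
  proof (rule integral_cong_AE)
    show "AE x in \<mu>. A_fun R2 (min R2 (max R1 x)) = A_fun R2 x"
      using AE_in_interval(1) by eventually_elim auto
  qed (auto simp: A_fun_def)
  also have "(LINT x|\<nu>. (LBINT r. ?f r * indicator {x..} r)) = (LINT x|\<nu>. A_fun R2 x)"
    unfolding inner
  proof (rule integral_cong_AE)
    show "AE x in \<nu>. A_fun R2 (min R2 (max R1 x)) = A_fun R2 x"
      using AE_in_interval(2) by eventually_elim auto
  qed (auto simp: A_fun_def)
  finally show ?thesis by simp
qed

text \<open>Let \<open>M\<close> be the total mass of \<open>\<mu>\<close>. Left of \<open>a\<close>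
  the difference is at most \<open>cdf \<mu> + cdf \<nu>\<close>. Right of \<open>a\<close>, writing
  \<open>cdf \<mu> - H = (M - H) - (M - cdf \<mu>)\<close> gives the bound
  \<open>|M - H| + (M - cdf \<mu>) + cdf \<nu>\<close>. Fubini turns the integrals of these bounds
  into first moments.\<close>

lemma L1_norm_le:
  assumes a: "a \<in> {R1..R2}"
  shows "L1_norm (\<lambda>r. u r - H * indicator {a<..<R2} r)
    \<le> (R2 - a) * \<bar>measure \<mu> UNIV - H\<bar> + (LINT x|\<mu>. \<bar>x - a\<bar>) + (LINT x|\<nu>. R2 - x)"
proof -
  let ?M = "measure \<mu> UNIV"
  \<comment> \<open>The pointwise majorant. Its closed pieces overlap at \<open>a\<close>, which
    only increases it because \<open>cdf \<mu>\<close> stays below the total mass.\<close>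
  define w where "w r = indicator {R1..a} r * cdf \<mu> r + (\<bar>?M - H\<bar> + ?M) * indicator {a..R2} r
    - indicator {a..R2} r * cdf \<mu> r + indicator {R1..R2} r * cdf \<nu> r" for r
  have ii: "integrable lborel (indicator {x..y} :: real \<Rightarrow> real)" for x y :: real
    by (rule integrable_real_indicator) (auto intro!: emeasure_bounded_finite simp flip: infinity_ennreal_def)
  have tail: "(LBINT r. indicator {c..d} r * indicator {x..} r) = max 0 (d - max c x)" for c d x :: real
  proof -
    have "(\<lambda>r. indicator {c..d} r * indicator {x..} r :: real) = indicator {max c x..d}"
      by (auto simp: indicator_def)
    then show ?thesis by (simp add: max_def)
  qed
  note imu = m.integrable_mult_cdf[OF ii] and inu = n.integrable_mult_cdf[OF ii]
  have w_int: "integrable lborel w"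
    unfolding w_def using imu inu ii by simp
  have w_ge: "AE r in lebesgue. \<bar>u r - H * indicator {a<..<R2} r\<bar> \<le> w r"
    using u_eq_cdf u_outside
  proof eventually_elim
    case (elim r)
    have b: "0 \<le> cdf \<mu> r" "0 \<le> cdf \<nu> r" "cdf \<mu> r \<le> ?M"
      using m.cdf_nonneg n.cdf_nonneg m.cdf_bounded[of r] by (auto simp: m.borel_UNIV)
    consider "r \<notin> {R1..R2}" | "r = R2" | "r \<in> {R1..a}" "r < R2" | "r \<in> {a<..<R2}"
      using a by (cases "r \<in> {R1..R2}"; cases "r = R2"; cases "r \<le> a") auto
    then show ?case
    proof cases
      case 1 then show ?thesis using elim a by (auto simp: w_def indicator_def)
    next
      case 2
      then have "u r = 0" using elim cdf_eq[of r] by simp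
      then show ?thesis using 2 b a R1_less_R2 by (auto simp: w_def indicator_def)
    next
      case 3
      then show ?thesis using elim b a by (auto simp: w_def indicator_def)
    next
      case 4
      then show ?thesis using elim b a by (auto simp: w_def indicator_def)
    qed
  qed
  have "L1_norm (\<lambda>r. u r - H * indicator {a<..<R2} r) \<le> (LINT r|lebesgue. w r)"
    unfolding L1_norm_def
  proof (rule integral_mono_AE)
    show "integrable lebesgue w" using w_int by (simp add: integrable_completion)
    have "integrable lborel (\<lambda>r. H * indicator {a<..<R2} r)"
      by (intro integrable_mult_right integrable_real_indicator)
        (auto intro!: emeasure_bounded_finite simp flip: infinity_ennreal_def)
    then show "integrable lebesgue (\<lambda>r. \<bar>u r - H * indicator {a<..<R2} r\<bar>)"
      using u_integrable
      by (intro Bochner_Integration.integrable_abs Bochner_Integration.integrable_diff)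
        (auto simp: integrable_completion)
  qed (rule w_ge)
  also have "\<dots> = (LBINT r. w r)"
    using w_int by (intro integral_completion) auto
  also have "\<dots> = (LBINT r. indicator {R1..a} r * cdf \<mu> r) + (\<bar>?M - H\<bar> + ?M) * (R2 - a)
      - (LBINT r. indicator {a..R2} r * cdf \<mu> r) + (LBINT r. indicator {R1..R2} r * cdf \<nu> r)"
    unfolding w_def using imu inu ii a by simp
  also have "(LBINT r. indicator {R1..a} r * cdf \<mu> r) = (LINT x|\<mu>. max 0 (a - x))"
    unfolding m.integral_mult_cdf[OF ii] tail
  proof (rule integral_cong_AE)
    show "AE x in \<mu>. max 0 (a - max R1 x) = max 0 (a - x)"
      using AE_in_interval(1) by eventually_elim (use a in auto)
  qed auto
  also have "(LBINT r. indicator {a..R2} r * cdf \<mu> r) = (LINT x|\<mu>. R2 - max a x)"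
    unfolding m.integral_mult_cdf[OF ii] tail
  proof (rule integral_cong_AE)
    show "AE x in \<mu>. max 0 (R2 - max a x) = R2 - max a x"
      using AE_in_interval(1) by eventually_elim (use a in auto)
  qed auto
  also have "(LBINT r. indicator {R1..R2} r * cdf \<nu> r) = (LINT x|\<nu>. R2 - x)"
    unfolding n.integral_mult_cdf[OF ii] tail
  proof (rule integral_cong_AE)
    show "AE x in \<nu>. max 0 (R2 - max R1 x) = R2 - x"
      using AE_in_interval(2) by eventually_elim (use a in auto)
  qed auto
  also have "(LINT x|\<mu>. max 0 (a - x)) + (\<bar>?M - H\<bar> + ?M) * (R2 - a) - (LINT x|\<mu>. R2 - max a x) + (LINT x|\<nu>. R2 - x)
      = (R2 - a) * \<bar>?M - H\<bar> + (LINT x|\<mu>. \<bar>x - a\<bar>) + (LINT x|\<nu>. R2 - x)"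
  proof -
    have i: "integrable \<mu> (\<lambda>x. max 0 (a - x))" "integrable \<mu> (\<lambda>x. R2 - max a x)"
      by (intro integrable_continuous continuous_intros)+
    have gen: "(LINT x|\<mu>. f x - g x + c) = (LINT x|\<mu>. f x) - (LINT x|\<mu>. g x) + c * ?M"
      if "integrable \<mu> f" "integrable \<mu> g" for f g :: "real \<Rightarrow> real" and c
      using that by (simp add: m.borel_UNIV)
    \<comment> \<open>\<open>max 0 (a - x)\<close> is the negative part of \<open>x - a\<close>, and
      \<open>(R2 - a) - (R2 - max a x)\<close> is its positive part.\<close>
    have "(LINT x|\<mu>. \<bar>x - a\<bar>) = (LINT x|\<mu>. max 0 (a - x) - (R2 - max a x) + (R2 - a))"
      by (intro Bochner_Integration.integral_cong) auto
    also have "\<dots> = (LINT x|\<mu>. max 0 (a - x)) - (LINT x|\<mu>. R2 - max a x) + (R2 - a) * ?M"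
      by (rule gen[OF i])
    finally show ?thesis by (simp add: algebra_simps)
  qed
  finally show ?thesis .
qed

end

section \<open>The gap function and the cubic\<close>

text \<open>In this form the derivatives of \<open>q\<close> are \<open>q\<close> times expressions
  in its logarithmic derivative.\<close>

lemma q_fun_eq_exp:
  assumes "0 < M" "2 * M < r"
  shows "q_fun M r = exp (7 / 2 * ln r - 1 / 2 * ln (r - 2 * M))"
  using assms by (simp add: q_fun_def powr_def exp_diff powr_half_sqrt[symmetric])

text \<open>Exhibits \<open>q\<close> as the integrand of the functional \<open>J\<close> with the
  mass profile frozen at the constant \<open>M\<close>.\<close>

lemma q_fun_eq_cube:
  assumes "0 < M" "2 * M < r"
  shows "q_fun M r = r ^ 3 / sqrt (1 - 2 * M / r)"
proof -
  have "r powr (7 / 2) = r powr (3 + 1 / 2)" by simp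
  also have "\<dots> = r ^ 3 * sqrt r"
    using assms by (subst powr_add) (simp add: powr_half_sqrt)
  finally have "r powr (7 / 2) = r ^ 3 * sqrt r" .
  moreover have "1 - 2 * M / r = (r - 2 * M) / r" using assms by (simp add: field_simps)
  ultimately show ?thesis using assms by (simp add: q_fun_def real_sqrt_divide)
qed

text \<open>\<open>q\<close> is convex on \<open>{2 * M<..}\<close>: with logarithmic derivative
  \<open>l\<close>, its second derivative is \<open>q * (l^2 + l')\<close>.\<close>

lemma q_fun_above_tangent:
  assumes M: "0 < M" and a: "2 * M < a" and r: "2 * M < r"
  shows "q_fun M a * (7 / (2 * a) - 1 / (2 * (a - 2 * M))) * (r - a) \<le> q_fun M r - q_fun M a"
proof -
  define f where "f x = exp (7 / 2 * ln x - 1 / 2 * ln (x - 2 * M))" for x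
  define l where "l x = 7 / 2 * inverse x - 1 / 2 * inverse (x - 2 * M)" for x
  define l' where "l' x = 1 / 2 * (inverse (x - 2 * M))\<^sup>2 - 7 / 2 * (inverse x)\<^sup>2" for x
  have f': "(f has_real_derivative f x * l x) (at x)" if "2 * M < x" for x
    unfolding f_def l_def using that M
    by (auto intro!: derivative_eq_intros simp: field_simps)
  have l': "(l has_real_derivative l' x) (at x)" if "2 * M < x" for x
    unfolding l_def l'_def using that M
    by (auto intro!: derivative_eq_intros simp: power2_eq_square)
  have "convex_on {2 * M<..} f"
  proof (rule f''_ge0_imp_convex)
    show "(f has_real_derivative f x * l x) (at x)" if "x \<in> {2 * M<..}" for x
      using f' that by simp
    show "((\<lambda>x. f x * l x) has_real_derivative f x * ((l x)\<^sup>2 + l' x)) (at x)" if "x \<in> {2 * M<..}" for x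
      using that by (auto intro!: derivative_eq_intros f' l' simp: power2_eq_square algebra_simps)
    show "0 \<le> f x * ((l x)\<^sup>2 + l' x)" for x
    proof -
      \<comment> \<open>Completing the square in \<open>inverse x\<close>: the expression is a
        positive definite quadratic form in \<open>inverse x\<close> and
        \<open>inverse (x - 2 * M)\<close>.\<close>
      have "(l x)\<^sup>2 + l' x
          = 35 / 4 * (inverse x - inverse (x - 2 * M) / 5)\<^sup>2 + 2 / 5 * (inverse (x - 2 * M))\<^sup>2"
        unfolding l_def l'_def by (simp add: power2_eq_square algebra_simps)
      also have "\<dots> \<ge> 0" by simp
      finally show ?thesis by (simp add: f_def)
    qed
  qed simp
  from convex_on_imp_above_tangent[OF this, of a r "f a * l a"]
  have "f a * l a * (r - a) \<le> f r - f a"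
    using a r f'[OF a] by (auto intro: has_field_derivative_at_within simp: connected_iff_interval interior_open)
  then show ?thesis using assms by (simp add: f_def l_def q_fun_eq_exp inverse_eq_divide)
qed

lemma q_fun_pos: "0 < M \<Longrightarrow> 2 * M < r \<Longrightarrow> 0 < q_fun M r"
  by (simp add: q_fun_def)

lemma A_fun_pos: "0 \<le> a \<Longrightarrow> a < R \<Longrightarrow> 0 < A_fun R a"
  by (simp add: A_fun_def power_strict_mono)

text \<open>The linear coefficient below is the derivative of \<open>q - \<lambda>A\<close> at \<open>a\<close>; up to a positive factor
  it is the cubic defining \<open>x\<^sub>0\<close>.\<close>

lemma gap_lower_bound:
  assumes M: "0 < M" and a: "2 * M < a" "a < R" and r: "2 * M < r" "r \<le> R"
  shows "q_fun M a * (M * a ^ 3 + 3 * R ^ 3 * a - 7 * M * R ^ 3) / (a * (a - 2 * M) * (R ^ 3 - a ^ 3)) * (r - a)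
      + 2 / 3 * a * Psi M R a * (r - a)\<^sup>2 \<le> q_fun M r - Psi M R a * A_fun R r"
proof -
  define h where "h = r - a"
  have pos: "0 < R ^ 3 - a ^ 3" "0 < a" "0 < a - 2 * M" "0 < q_fun M a"
    using M a by (simp_all add: power_strict_mono q_fun_pos)
  then have Apos: "0 < A_fun R a" by (simp add: A_fun_def)
  have qa: "q_fun M a = Psi M R a * A_fun R a" using Apos by (simp add: Psi_def)
  have Psi_pos: "0 < Psi M R a" using pos Apos by (simp add: Psi_def)
  have tangent: "q_fun M a * (7 / (2 * a) - 1 / (2 * (a - 2 * M))) * h \<le> q_fun M r - q_fun M a"
    unfolding h_def by (rule q_fun_above_tangent) fact+
  have "A_fun R r = A_fun R a - a\<^sup>2 * h - a * h\<^sup>2 - h ^ 3 / 3"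
    unfolding A_fun_def h_def by (simp add: power2_eq_square power3_eq_cube field_simps)
  \<comment> \<open>Since \<open>h + a = r > 0\<close>, the cubic term \<open>h^3 / 3\<close> is at
    least \<open>- a * h^2 / 3\<close>; this costs a third of \<open>a * h^2\<close> and leaves the
    factor 2/3.\<close>
  moreover have "0 \<le> (h + a) * h\<^sup>2" using r M by (simp add: h_def)
  ultimately have "A_fun R r \<le> A_fun R a - a\<^sup>2 * h - 2 / 3 * a * h\<^sup>2"
    by (simp add: power2_eq_square power3_eq_cube algebra_simps)
  then have "Psi M R a * A_fun R r \<le> Psi M R a * (A_fun R a - a\<^sup>2 * h - 2 / 3 * a * h\<^sup>2)"
    using Psi_pos by simp
  then have "Psi M R a * A_fun R r \<le> q_fun M a - Psi M R a * a\<^sup>2 * h - 2 / 3 * a * Psi M R a * h\<^sup>2"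
    by (simp add: qa algebra_simps)
  moreover have slope: "q_fun M a * (7 / (2 * a) - 1 / (2 * (a - 2 * M))) + Psi M R a * a\<^sup>2
      = q_fun M a * (M * a ^ 3 + 3 * R ^ 3 * a - 7 * M * R ^ 3) / (a * (a - 2 * M) * (R ^ 3 - a ^ 3))"
  proof -
    have Psi_a: "Psi M R a * a\<^sup>2 = q_fun M a * (3 * a\<^sup>2 / (R ^ 3 - a ^ 3))" by (simp add: Psi_def A_fun_def)
    have frac: "7 / (2 * a) - 1 / (2 * (a - 2 * M)) + 3 * a\<^sup>2 / (R ^ 3 - a ^ 3)
       = (M * a ^ 3 + 3 * R ^ 3 * a - 7 * M * R ^ 3) / (a * (a - 2 * M) * (R ^ 3 - a ^ 3))"
    proof -
      have frac: "7 / (2 * a) - 1 / (2 * s) + 3 * a\<^sup>2 / d = ((7 * s - a) * d + 6 * a ^ 3 * s) / (2 * (a * s * d))"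
        if "0 < s" "0 < d" for s d
        using that pos(2) by (simp add: field_simps power2_eq_square power3_eq_cube)
      \<comment> \<open>Over the common denominator the numerator is twice the cubic, and the 2
        cancels.\<close>
      have num: "(7 * (a - 2 * M) - a) * (R ^ 3 - a ^ 3) + 6 * a ^ 3 * (a - 2 * M)
          = 2 * (M * a ^ 3 + 3 * R ^ 3 * a - 7 * M * R ^ 3)"
        by (simp add: power3_eq_cube algebra_simps)
      show ?thesis
        unfolding frac[OF pos(3) pos(1)] num by (rule mult_divide_mult_cancel_left) simp
    qed
    have "q_fun M a * (7 / (2 * a) - 1 / (2 * (a - 2 * M))) + Psi M R a * a\<^sup>2
        = q_fun M a * (7 / (2 * a) - 1 / (2 * (a - 2 * M)) + 3 * a\<^sup>2 / (R ^ 3 - a ^ 3))"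
      by (simp only: Psi_a distrib_left)
    then show ?thesis unfolding frac by simp
  qed
  ultimately show ?thesis
    using tangent unfolding slope[symmetric] distrib_right h_def[symmetric] by linarith
qed

section \<open>The root of the cubic\<close>

lemma cubic_strict_mono:
  fixes M R x y :: real
  assumes "0 < M" "0 < R" "x < y"
  shows "M * x ^ 3 + 3 * R ^ 3 * x - 7 * M * R ^ 3 < M * y ^ 3 + 3 * R ^ 3 * y - 7 * M * R ^ 3"
proof -
  have "M * x ^ 3 \<le> M * y ^ 3" using assms by (intro mult_left_mono power_mono_odd) auto
  moreover have "3 * R ^ 3 * x < 3 * R ^ 3 * y" using assms by simp
  ultimately show ?thesis by linarith
qed

text \<open>The cubic is negative at 0 and equals \<open>3 * R^3 * (R - 2 * M) > 0\<close> at
  \<open>R\<close>, so it has a root in between; strict monotonicity makes the root unique, so the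
  description operator in \<open>x0\<close> is legitimate.\<close>

lemma x0_root:
  assumes "0 < M" "2 * M < R"
  shows "M * x0 M R ^ 3 + 3 * R ^ 3 * x0 M R - 7 * M * R ^ 3 = 0" and "x0 M R < R"
proof -
  define p where "p x = M * x ^ 3 + 3 * R ^ 3 * x - 7 * M * R ^ 3" for x
  have R: "0 < R" using assms by simp
  have mono: "p x < p y" if "x < y" for x y
    unfolding p_def using cubic_strict_mono[OF assms(1) R that] .
  have pR: "0 < p R"
  proof -
    have "p R = 3 * R ^ 3 * (R - 2 * M)" by (simp add: p_def algebra_simps power3_eq_cube)
    then show ?thesis using assms R by simp
  qed
  have p0: "p 0 < 0" using assms R by (simp add: p_def)
  have "\<exists>x\<ge>0. x \<le> R \<and> p x = 0"
    by (rule IVT') (use p0 pR R in \<open>auto simp: p_def intro!: continuous_intros\<close>)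
  then obtain x where x: "p x = 0" by blast
  have "p (x0 M R) = 0"
    unfolding x0_def p_def[symmetric]
    by (rule theI[where P = "\<lambda>x. p x = 0", OF x]) (metis mono x less_irrefl linorder_neqE_linordered_idom)
  then show "M * x0 M R ^ 3 + 3 * R ^ 3 * x0 M R - 7 * M * R ^ 3 = 0" by (simp add: p_def)
  show "x0 M R < R"
    using pR \<open>p (x0 M R) = 0\<close> mono by (metis less_asym less_irrefl linorder_neqE_linordered_idom)
qed

section \<open>Profiles and the deficit\<close>

lemma set_integrable_square_mult:
  fixes w :: "real \<Rightarrow> real"
  assumes w: "integrable lebesgue w" and "0 \<le> R1"
  shows "set_integrable lebesgue {R1..r} (\<lambda>s. s\<^sup>2 * w s)"
  unfolding set_integrable_def
proof (rule Bochner_Integration.integrable_bound)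
  show "integrable lebesgue (\<lambda>s. r\<^sup>2 * w s)" using w by simp
  have "(\<lambda>s. indicator {R1..r} s *\<^sub>R s\<^sup>2 :: real) \<in> borel_measurable lebesgue"
    by (rule measurable_completion) simp
  then have "(\<lambda>s. (indicator {R1..r} s *\<^sub>R s\<^sup>2) * w s) \<in> borel_measurable lebesgue"
    using w by (intro borel_measurable_times) auto
  then show "(\<lambda>s. indicator {R1..r} s *\<^sub>R (s\<^sup>2 * w s)) \<in> borel_measurable lebesgue"
    by (simp add: mult.assoc)
  show "AE s in lebesgue. norm (indicator {R1..r} s *\<^sub>R (s\<^sup>2 * w s)) \<le> norm (r\<^sup>2 * w s)"
    using \<open>0 \<le> R1\<close>
    by (intro AE_I2) (auto simp: indicator_def abs_mult intro!: mult_right_mono power_mono)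
qed

text \<open>Lipschitz dependence from \<open>L1\<close> to the sup norm: the weight
  \<open>s^2\<close> is at most \<open>R2^2\<close> on the range of integration.\<close>

lemma P_fun_diff_le:
  assumes u: "integrable lebesgue u" and w: "integrable lebesgue w" and "0 \<le> R1" "r \<le> R2"
  shows "\<bar>P_fun R1 u r - P_fun R1 w r\<bar> \<le> R2\<^sup>2 * L1_norm (\<lambda>r. u r - w r)"
proof -
  note su = set_integrable_square_mult[OF u \<open>0 \<le> R1\<close>, of r]
  note sw = set_integrable_square_mult[OF w \<open>0 \<le> R1\<close>, of r]
  have eq: "P_fun R1 u r - P_fun R1 w r
      = (LINT s|lebesgue. indicator {R1..r} s *\<^sub>R (s\<^sup>2 * u s) - indicator {R1..r} s *\<^sub>R (s\<^sup>2 * w s))"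
    using su sw unfolding P_fun_def set_lebesgue_integral_def set_integrable_def
    by (simp only: Bochner_Integration.integral_diff)
  have "\<bar>P_fun R1 u r - P_fun R1 w r\<bar>
      \<le> (LINT s|lebesgue. \<bar>indicator {R1..r} s *\<^sub>R (s\<^sup>2 * u s) - indicator {R1..r} s *\<^sub>R (s\<^sup>2 * w s)\<bar>)"
    unfolding eq by (rule integral_abs_bound)
  also have "\<dots> \<le> (LINT s|lebesgue. R2\<^sup>2 * \<bar>u s - w s\<bar>)"
  proof (rule integral_mono)
    show "integrable lebesgue (\<lambda>s. \<bar>indicator {R1..r} s *\<^sub>R (s\<^sup>2 * u s) - indicator {R1..r} s *\<^sub>R (s\<^sup>2 * w s)\<bar>)"
      using su sw unfolding set_integrable_def by (intro Bochner_Integration.integrable_abs Bochner_Integration.integrable_diff)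
    show "integrable lebesgue (\<lambda>s. R2\<^sup>2 * \<bar>u s - w s\<bar>)" using u w by simp
    fix s
    have "s\<^sup>2 * \<bar>u s - w s\<bar> \<le> R2\<^sup>2 * \<bar>u s - w s\<bar>" if "s \<in> {R1..r}"
      using that assms by (intro mult_right_mono power_mono) auto
    moreover have "\<bar>s\<^sup>2 * u s - s\<^sup>2 * w s\<bar> = s\<^sup>2 * \<bar>u s - w s\<bar>"
      by (simp add: abs_mult flip: right_diff_distrib)
    ultimately show "\<bar>indicator {R1..r} s *\<^sub>R (s\<^sup>2 * u s) - indicator {R1..r} s *\<^sub>R (s\<^sup>2 * w s)\<bar>
        \<le> R2\<^sup>2 * \<bar>u s - w s\<bar>"
      by (cases "s \<in> {R1..r}") auto
  qed
  also have "\<dots> = R2\<^sup>2 * L1_norm (\<lambda>r. u r - w r)" by (simp add: L1_norm_def)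
  finally show ?thesis .
qed

lemma P_fun_mono:
  assumes w: "integrable lebesgue w" "AE r in lebesgue. 0 \<le> w r" and "0 \<le> R1"
  shows "mono (P_fun R1 w)"
proof (rule monoI)
  fix r t :: real assume "r \<le> t"
  show "P_fun R1 w r \<le> P_fun R1 w t"
    unfolding P_fun_def set_lebesgue_integral_def
  proof (rule integral_mono_AE)
    show "AE s in lebesgue. indicator {R1..r} s *\<^sub>R (s\<^sup>2 * w s) \<le> indicator {R1..t} s *\<^sub>R (s\<^sup>2 * w s)"
      using w(2) by eventually_elim (use \<open>r \<le> t\<close> in \<open>auto simp: indicator_def\<close>)
  qed (use set_integrable_square_mult[OF w(1) \<open>0 \<le> R1\<close>] in \<open>auto simp: set_integrable_def\<close>)
qed

lemma P_fun_bounds: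
  assumes w: "integrable lebesgue w" "AE r in lebesgue. 0 \<le> w r" and "0 \<le> R1"
    and mass: "(LINT r:{R1..R2}|lebesgue. r\<^sup>2 * w r) = 1" and "r \<le> R2"
  shows "0 \<le> P_fun R1 w r" "P_fun R1 w r \<le> 1"
proof -
  show "0 \<le> P_fun R1 w r"
    unfolding P_fun_def set_lebesgue_integral_def
    by (rule integral_nonneg_AE) (use w(2) in \<open>auto elim!: eventually_mono\<close>)
  show "P_fun R1 w r \<le> 1"
    using monoD[OF P_fun_mono[OF w \<open>0 \<le> R1\<close>] \<open>r \<le> R2\<close>] mass by (simp add: P_fun_def)
qed

lemma Linf_norm_le:
  assumes "f \<in> borel_measurable borel" and "\<And>r. r \<in> {R1..R2} \<Longrightarrow> \<bar>f r\<bar> \<le> B"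
  shows "Linf_norm R1 R2 f \<le> ereal B"
  unfolding Linf_norm_def
proof (rule esssup_I)
  have "(\<lambda>r. ereal \<bar>f r\<bar>) \<in> borel_measurable lborel" using assms(1) by simp
  then have "(\<lambda>r. ereal \<bar>f r\<bar>) \<in> borel_measurable lebesgue" by (rule measurable_completion)
  then show "(\<lambda>r. ereal \<bar>f r\<bar>) \<in> borel_measurable (restrict_space lebesgue {R1..R2})"
    by (rule measurable_restrict_space1)
  show "AE r in restrict_space lebesgue {R1..R2}. ereal \<bar>f r\<bar> \<le> ereal B"
    by (rule AE_I2) (use assms(2) in \<open>auto simp: space_restrict_space\<close>)
qed

text \<open>\<open>P\<close> between 0 and 1 puts the mass between \<open>M1\<close> and
  \<open>M2\<close>. The lower bound is made uniform in \<open>r\<close>, for inverting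
  \<open>F\<close>; the upper one keeps \<open>r\<close>, for comparison with
  \<open>q\<close>.\<close>

lemma F_fun_bounds:
  fixes M1 M2 R1 r :: real
  assumes "0 < M1" "M1 < M2" "2 * M2 < R1" "R1 \<le> r"
    and P: "0 \<le> P_fun R1 w r" "P_fun R1 w r \<le> 1"
  shows "1 - 2 * M2 / R1 \<le> F_fun M1 M2 R1 w r" "F_fun M1 M2 R1 w r \<le> 1 - 2 * M1 / r"
proof -
  have r: "0 < r" "0 < R1" using assms by auto
  have "(M2 - M1) * P_fun R1 w r \<le> (M2 - M1) * 1"
    using P assms by (intro mult_left_mono) auto
  then have m: "m_fun M1 M2 R1 w r \<le> M2" by (simp add: m_fun_def)
  have "M1 \<le> m_fun M1 M2 R1 w r" using P assms by (simp add: m_fun_def)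
  then show "F_fun M1 M2 R1 w r \<le> 1 - 2 * M1 / r"
    using r by (simp add: F_fun_def divide_right_mono)
  have "2 * m_fun M1 M2 R1 w r / r \<le> 2 * M2 / r" using m r by (simp add: divide_right_mono)
  also have "\<dots> \<le> 2 * M2 / R1" using assms r by (intro divide_left_mono) auto
  finally show "1 - 2 * M2 / R1 \<le> F_fun M1 M2 R1 w r" by (simp add: F_fun_def)
qed

text \<open>The height \<open>1 / A_fun R2 a\<close> normalises the mass to 1. These facts give
  \<open>F\<close> of the minimizer the same positive lower bound as \<open>F\<close> of
  \<open>u\<close>.\<close>

lemma u_star_props:
  assumes "0 < M1" "2 * M1 < R1" "R1 < R2"
  shows "integrable lebesgue (u_star M1 R1 R2)" "AE r in lebesgue. 0 \<le> u_star M1 R1 R2 r"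
    and "(LINT r:{R1..R2}|lebesgue. r\<^sup>2 * u_star M1 R1 R2 r) = 1"
proof -
  define a where "a = a_opt M1 R1 R2"
  have a: "R1 \<le> a" "a < R2" using x0_root(2)[of M1 R2] assms by (auto simp: a_def a_opt_def)
  have Apos: "0 < A_fun R2 a" using a assms by (intro A_fun_pos) auto
  have "integrable lborel (u_star M1 R1 R2)"
    unfolding u_star_def
    by (intro integrable_mult_right integrable_real_indicator)
      (auto intro!: emeasure_bounded_finite simp flip: infinity_ennreal_def)
  then show "integrable lebesgue (u_star M1 R1 R2)" by (simp add: integrable_completion)
  show "AE r in lebesgue. 0 \<le> u_star M1 R1 R2 r"
    using Apos by (intro AE_I2) (auto simp: u_star_def H_star_def a_def)
  have "(LINT r:{R1..R2}|lebesgue. r\<^sup>2 * u_star M1 R1 R2 r)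
      = (LBINT r. indicator {R1..R2} r *\<^sub>R (r\<^sup>2 * u_star M1 R1 R2 r))"
    unfolding set_lebesgue_integral_def u_star_def by (rule integral_completion) simp
  also have "\<dots> = (LBINT r. 1 / A_fun R2 a * (r\<^sup>2 * indicator {a..R2} r))"
  proof (rule integral_cong_AE)
    have "AE r in lborel. r \<noteq> a \<and> r \<noteq> R2"
      by (intro AE_conjI AE_lborel_singleton)
    then show "AE r in lborel. indicator {R1..R2} r *\<^sub>R (r\<^sup>2 * u_star M1 R1 R2 r)
        = 1 / A_fun R2 a * (r\<^sup>2 * indicator {a..R2} r)"
      by eventually_elim
        (use a in \<open>auto simp: u_star_def H_star_def indicator_def simp flip: a_def\<close>)
  qed (auto simp: u_star_def)
  also have "\<dots> = 1 / A_fun R2 a * ((R2 ^ 3 - a ^ 3) / 3)"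
    using a by (simp only: integral_mult_right_zero) (simp add: LBINT_power2_Icc)
  also have "\<dots> = 1" using Apos by (simp add: A_fun_def)
  finally show "(LINT r:{R1..R2}|lebesgue. r\<^sup>2 * u_star M1 R1 R2 r) = 1" .
qed

section \<open>Deficit, moment and distance estimates for one admissible function\<close>

locale admissible_mass = admissible +
  fixes M1 M2 :: real
  assumes M1_pos: "0 < M1" and M1_less_M2: "M1 < M2" and M2_less: "2 * M2 < R1"
begin

lemma P_meas: "P_fun R1 u \<in> borel_measurable borel"
  using P_fun_mono[OF u_integrable u_nonneg] R1_pos by (intro borel_measurable_mono) simp

lemma F_bounds:
  assumes "r \<in> {R1..R2}"
  shows "1 - 2 * M2 / R1 \<le> F_fun M1 M2 R1 u r" "F_fun M1 M2 R1 u r \<le> 1 - 2 * M1 / r"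
  using assms R1_pos P_fun_bounds[OF u_integrable u_nonneg _ u_mass, of r]
    F_fun_bounds[of M1 M2 R1 r u] M1_pos M1_less_M2 M2_less by auto

lemma f0_pos: "0 < 1 - 2 * M2 / R1" using R1_pos M2_less by simp

text \<open>\<open>F \<le> 1 - 2 * M1 / x\<close> gives the comparison with \<open>q\<close>. The
  constant lower bound later controls the total mass of \<open>\<mu>\<close>, and the constant upper
  bound gives integrability.\<close>

lemma q_le_integrand:
  assumes "x \<in> {R1..R2}"
  shows "R1 ^ 3 \<le> q_fun M1 x" "q_fun M1 x \<le> x ^ 3 / sqrt (F_fun M1 M2 R1 u x)"
    "x ^ 3 / sqrt (F_fun M1 M2 R1 u x) \<le> R2 ^ 3 / sqrt (1 - 2 * M2 / R1)"
proof -
  note F = F_bounds[OF assms] f0_pos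
  have x: "0 < x" "R1 \<le> x" "x \<le> R2" "2 * M1 < x"
    using assms R1_pos M1_less_M2 M2_less by auto
  have q: "q_fun M1 x = x ^ 3 / sqrt (1 - 2 * M1 / x)"
    using x M1_pos by (intro q_fun_eq_cube)
  have s: "0 < sqrt (F_fun M1 M2 R1 u x)" "sqrt (F_fun M1 M2 R1 u x) \<le> sqrt (1 - 2 * M1 / x)"
    "sqrt (1 - 2 * M1 / x) \<le> 1"
    using F x M1_pos by (auto simp: divide_nonneg_pos)
  show "q_fun M1 x \<le> x ^ 3 / sqrt (F_fun M1 M2 R1 u x)"
    unfolding q using s x by (intro divide_left_mono) auto
  have "R1 ^ 3 \<le> x ^ 3" using x R1_pos by (intro power_mono) auto
  also have "x ^ 3 / 1 \<le> x ^ 3 / sqrt (1 - 2 * M1 / x)"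
    using s x by (intro divide_left_mono) auto
  finally show "R1 ^ 3 \<le> q_fun M1 x" by (simp add: q)
  show "x ^ 3 / sqrt (F_fun M1 M2 R1 u x) \<le> R2 ^ 3 / sqrt (1 - 2 * M2 / R1)"
    using F x by (intro frac_le power_mono) auto
qed

lemma q_integrable: "integrable \<mu> (q_fun M1)"
proof (rule integrable_bounded(1))
  show "q_fun M1 \<in> borel_measurable borel" unfolding q_fun_def by measurable
  show "\<bar>q_fun M1 x\<bar> \<le> R2 ^ 3 / sqrt (1 - 2 * M2 / R1)" if "x \<in> {R1..R2}" for x
    using q_le_integrand[OF that] R1_pos by (smt (verit) zero_less_power)
qed

lemma q_integral_le_J: "(LINT x|\<mu>. q_fun M1 x) \<le> J M1 M2 R1 R2 u"
  unfolding J_def set_lebesgue_integral_def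
proof (rule integral_mono_AE[OF q_integrable])
  show "integrable \<mu> (\<lambda>r. indicator {R1..R2} r *\<^sub>R (r ^ 3 / sqrt (F_fun M1 M2 R1 u r)))"
  proof (rule integrable_bounded(1))
    show "(\<lambda>r. indicator {R1..R2} r *\<^sub>R (r ^ 3 / sqrt (F_fun M1 M2 R1 u r))) \<in> borel_measurable borel"
      using P_meas unfolding F_fun_def m_fun_def by measurable
    show "\<bar>indicator {R1..R2} x *\<^sub>R (x ^ 3 / sqrt (F_fun M1 M2 R1 u x))\<bar> \<le> R2 ^ 3 / sqrt (1 - 2 * M2 / R1)"
      if "x \<in> {R1..R2}" for x
      using q_le_integrand[OF that] R1_pos that
      by (smt (verit) zero_less_power indicator_simps(1) scaleR_one)
  qed
  show "AE x in \<mu>. q_fun M1 x \<le> indicator {R1..R2} x *\<^sub>R (x ^ 3 / sqrt (F_fun M1 M2 R1 u x))"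
    using AE_in_interval(1) by eventually_elim (use q_le_integrand in auto)
qed

lemma A_integrable: "integrable \<mu> (A_fun R2)" "integrable \<nu> (A_fun R2)"
  by (intro integrable_continuous, simp add: A_fun_def, intro continuous_intros, simp)+

text \<open>A Lagrange multiplier argument: \<open>l\<close> times the mass identity is subtracted
  from \<open>\<integral> q d\<mu> \<le> J\<close>. It is stated for every \<open>l\<close>; a
  useful \<open>l\<close> makes \<open>q - l * A\<close> nonnegative.\<close>

lemma deficit_ge:
  "(LINT x|\<mu>. q_fun M1 x - l * A_fun R2 x) + l * (LINT x|\<nu>. A_fun R2 x) \<le> J M1 M2 R1 R2 u - l"
proof -
  have "(LINT x|\<mu>. q_fun M1 x - l * A_fun R2 x) = (LINT x|\<mu>. q_fun M1 x) - l * (LINT x|\<mu>. A_fun R2 x)"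
    using q_integrable A_integrable by simp
  moreover have "l * (LINT x|\<mu>. A_fun R2 x) = l * (1 + (LINT x|\<nu>. A_fun R2 x))"
    using mass_identity by simp
  ultimately show ?thesis using q_integral_le_J by (simp add: algebra_simps)
qed

lemma total_mass_le: "R1 ^ 3 * measure \<mu> UNIV \<le> J M1 M2 R1 R2 u"
proof -
  have "R1 ^ 3 * measure \<mu> UNIV = (LINT x|\<mu>. R1 ^ 3)" by (simp add: m.borel_UNIV)
  also have "\<dots> \<le> (LINT x|\<mu>. q_fun M1 x)"
  proof (rule integral_mono_AE[OF _ q_integrable])
    show "AE x in \<mu>. R1 ^ 3 \<le> q_fun M1 x"
      using AE_in_interval(1) by eventually_elim (rule q_le_integrand)
  qed simp
  finally show ?thesis using q_integral_le_J by simp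
qed

text \<open>\<open>R2^3 - x^3\<close> is \<open>R2 - x\<close> times a factor between
  \<open>R2^2\<close> and \<open>3 * R2^2\<close>.\<close>

lemma A_fun_bounds:
  assumes "x \<in> {R1..R2}"
  shows "R2\<^sup>2 / 3 * (R2 - x) \<le> A_fun R2 x" "A_fun R2 x \<le> R2\<^sup>2 * (R2 - x)"
proof -
  have A: "A_fun R2 x = (R2\<^sup>2 + R2 * x + x\<^sup>2) / 3 * (R2 - x)"
    by (simp add: A_fun_def power2_eq_square power3_eq_cube algebra_simps)
  have x: "0 \<le> x" "x \<le> R2" using assms R1_pos by auto
  then have "R2 * x \<le> R2\<^sup>2" "x\<^sup>2 \<le> R2\<^sup>2" "0 \<le> R2 * x"
    by (auto simp: power2_eq_square intro: mult_mono)
  then have "R2\<^sup>2 / 3 \<le> (R2\<^sup>2 + R2 * x + x\<^sup>2) / 3" "(R2\<^sup>2 + R2 * x + x\<^sup>2) / 3 \<le> R2\<^sup>2"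
    by auto
  then show "R2\<^sup>2 / 3 * (R2 - x) \<le> A_fun R2 x" "A_fun R2 x \<le> R2\<^sup>2 * (R2 - x)"
    unfolding A using x by (intro mult_right_mono; simp)+
qed

text \<open>Both terms on the left of \<open>deficit_ge\<close> are nonnegative, so each is bounded
  by the deficit alone. The weight \<open>k\<close> stands for the quadratic or the linear
  gap.\<close>

lemma moment_bounds:
  assumes gap: "\<And>x. x \<in> {R1..R2} \<Longrightarrow> c * k x \<le> q_fun M1 x - l * A_fun R2 x"
    and k: "continuous_on UNIV k" "\<And>x. x \<in> {R1..R2} \<Longrightarrow> 0 \<le> k x" and "0 < c" "0 < l"
  shows "(LINT x|\<mu>. k x) \<le> (J M1 M2 R1 R2 u - l) / c"
    and "(LINT x|\<nu>. R2 - x) \<le> 3 / (l * R2\<^sup>2) * (J M1 M2 R1 R2 u - l)"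
proof -
  let ?d = "J M1 M2 R1 R2 u - l"
  have "(LINT x|\<mu>. c * k x) \<le> (LINT x|\<mu>. q_fun M1 x - l * A_fun R2 x)"
  proof (rule integral_mono_AE)
    show "integrable \<mu> (\<lambda>x. c * k x)" using integrable_continuous(1)[OF k(1)] by simp
    show "integrable \<mu> (\<lambda>x. q_fun M1 x - l * A_fun R2 x)" using q_integrable A_integrable by simp
    show "AE x in \<mu>. c * k x \<le> q_fun M1 x - l * A_fun R2 x"
      using AE_in_interval(1) by eventually_elim (rule gap)
  qed
  then have 1: "c * (LINT x|\<mu>. k x) \<le> (LINT x|\<mu>. q_fun M1 x - l * A_fun R2 x)" by simp
  have "0 \<le> (LINT x|\<mu>. k x)"
  proof (rule integral_nonneg_AE)
    show "AE x in \<mu>. 0 \<le> k x" using AE_in_interval(1) by eventually_elim (rule k(2))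
  qed
  then have k0: "0 \<le> c * (LINT x|\<mu>. k x)" using \<open>0 < c\<close> by simp
  have "(LINT x|\<nu>. R2\<^sup>2 / 3 * (R2 - x)) \<le> (LINT x|\<nu>. A_fun R2 x)"
  proof (rule integral_mono_AE[OF _ A_integrable(2)])
    show "integrable \<nu> (\<lambda>x. R2\<^sup>2 / 3 * (R2 - x))"
      by (intro integrable_continuous continuous_intros)
    show "AE x in \<nu>. R2\<^sup>2 / 3 * (R2 - x) \<le> A_fun R2 x"
      using AE_in_interval(2) by eventually_elim (rule A_fun_bounds)
  qed
  then have 2: "R2\<^sup>2 / 3 * (LINT x|\<nu>. R2 - x) \<le> (LINT x|\<nu>. A_fun R2 x)"
    by (simp only: integral_mult_right_zero)
  have "0 \<le> (LINT x|\<nu>. R2 - x)"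
  proof (rule integral_nonneg_AE)
    show "AE x in \<nu>. 0 \<le> R2 - x" using AE_in_interval(2) by eventually_elim simp
  qed
  then have "0 \<le> R2\<^sup>2 / 3 * (LINT x|\<nu>. R2 - x)" by simp
  then have A0: "0 \<le> (LINT x|\<nu>. A_fun R2 x)" using 2 by linarith
  have "c * (LINT x|\<mu>. k x) \<le> ?d"
    using 1 deficit_ge[of l] mult_nonneg_nonneg[OF less_imp_le[OF \<open>0 < l\<close>] A0] by linarith
  then show "(LINT x|\<mu>. k x) \<le> ?d / c" using \<open>0 < c\<close> by (simp add: field_simps)
  have "l * (R2\<^sup>2 / 3 * (LINT x|\<nu>. R2 - x)) \<le> ?d"
    using mult_left_mono[OF 2, of l] \<open>0 < l\<close> 1 k0 deficit_ge[of l] by linarith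
  then show "(LINT x|\<nu>. R2 - x) \<le> 3 / (l * R2\<^sup>2) * ?d"
    using \<open>0 < l\<close> R1_pos R1_less_R2 by (simp add: field_simps)
qed

text \<open>It remains to bound \<open>M - 1 / A(a)\<close>, where \<open>M\<close> is the mass of
  \<open>\<mu>\<close>. By the mass identity \<open>A(a) * M - 1 = \<integral> (A(a) - A) d\<mu> +
  \<integral> A d\<nu>\<close>, and \<open>A\<close> is Lipschitz with constant \<open>R2^2\<close>
  and vanishes at \<open>R2\<close>.\<close>

lemma L1_norm_le_moments:
  assumes a: "R1 \<le> a" "a < R2"
  shows "L1_norm (\<lambda>r. u r - 1 / A_fun R2 a * indicator {a<..<R2} r)
    \<le> ((R2 - a) * R2\<^sup>2 / A_fun R2 a + 1) * ((LINT x|\<mu>. \<bar>x - a\<bar>) + (LINT x|\<nu>. R2 - x))"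
proof -
  let ?M = "measure \<mu> UNIV" and ?E = "LINT x|\<mu>. \<bar>x - a\<bar>" and ?N = "LINT x|\<nu>. R2 - x"
  have Apos: "0 < A_fun R2 a" using a R1_pos by (intro A_fun_pos) auto
  have "\<bar>(LINT x|\<mu>. A_fun R2 a - A_fun R2 x)\<bar> \<le> (LINT x|\<mu>. \<bar>A_fun R2 a - A_fun R2 x\<bar>)"
    by (rule integral_abs_bound)
  also have "\<dots> \<le> (LINT x|\<mu>. R2\<^sup>2 * \<bar>x - a\<bar>)"
  proof (rule integral_mono_AE)
    show "integrable \<mu> (\<lambda>x. \<bar>A_fun R2 a - A_fun R2 x\<bar>)" using A_integrable(1) by simp
    show "integrable \<mu> (\<lambda>x. R2\<^sup>2 * \<bar>x - a\<bar>)" by (intro integrable_continuous continuous_intros)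
    show "AE x in \<mu>. \<bar>A_fun R2 a - A_fun R2 x\<bar> \<le> R2\<^sup>2 * \<bar>x - a\<bar>"
      using AE_in_interval(1)
    proof eventually_elim
      case (elim x)
      have "A_fun R2 a - A_fun R2 x = (a\<^sup>2 + a * x + x\<^sup>2) / 3 * (x - a)"
        by (simp add: A_fun_def power2_eq_square power3_eq_cube field_simps)
      then have abs_eq: "\<bar>A_fun R2 a - A_fun R2 x\<bar> = \<bar>(a\<^sup>2 + a * x + x\<^sup>2) / 3\<bar> * \<bar>x - a\<bar>"
        by (simp only: abs_mult)
      have "a * x \<le> R2\<^sup>2" "x\<^sup>2 \<le> R2\<^sup>2" "a\<^sup>2 \<le> R2\<^sup>2" "0 \<le> a * x"
        using elim a R1_pos by (auto simp: power2_eq_square intro: mult_mono)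
      then have "\<bar>(a\<^sup>2 + a * x + x\<^sup>2) / 3\<bar> \<le> R2\<^sup>2" by simp
      then show ?case unfolding abs_eq by (rule mult_right_mono) simp
    qed
  qed
  also have "\<dots> = R2\<^sup>2 * ?E" by simp
  finally have 1: "\<bar>A_fun R2 a * ?M - (LINT x|\<mu>. A_fun R2 x)\<bar> \<le> R2\<^sup>2 * ?E"
    using A_integrable(1) by (simp add: m.borel_UNIV mult.commute)
  have "(LINT x|\<nu>. A_fun R2 x) \<le> (LINT x|\<nu>. R2\<^sup>2 * (R2 - x))"
  proof (rule integral_mono_AE[OF A_integrable(2)])
    show "integrable \<nu> (\<lambda>x. R2\<^sup>2 * (R2 - x))" by (intro integrable_continuous continuous_intros)
    show "AE x in \<nu>. A_fun R2 x \<le> R2\<^sup>2 * (R2 - x)"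
      using AE_in_interval(2) by eventually_elim (rule A_fun_bounds)
  qed
  then have 2: "(LINT x|\<nu>. A_fun R2 x) \<le> R2\<^sup>2 * ?N" by (simp only: integral_mult_right_zero)
  have "0 \<le> (LINT x|\<nu>. A_fun R2 x)"
  proof (rule integral_nonneg_AE)
    show "AE x in \<nu>. 0 \<le> A_fun R2 x"
      using AE_in_interval(2) by eventually_elim (use R1_pos in \<open>auto simp: A_fun_def power_mono\<close>)
  qed
  with 1 2 have "\<bar>A_fun R2 a * ?M - 1\<bar> \<le> R2\<^sup>2 * (?E + ?N)"
    using mass_identity by (simp add: algebra_simps)
  moreover have "\<bar>?M - 1 / A_fun R2 a\<bar> = \<bar>A_fun R2 a * ?M - 1\<bar> / A_fun R2 a"
  proof -
    have "?M - 1 / A_fun R2 a = (A_fun R2 a * ?M - 1) / A_fun R2 a"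
      using Apos by (simp add: field_simps)
    then show ?thesis using Apos by (simp only: abs_divide abs_of_pos)
  qed
  ultimately have "\<bar>?M - 1 / A_fun R2 a\<bar> \<le> R2\<^sup>2 * (?E + ?N) / A_fun R2 a"
    using Apos by (simp add: divide_right_mono)
  then have "(R2 - a) * \<bar>?M - 1 / A_fun R2 a\<bar> \<le> (R2 - a) * (R2\<^sup>2 * (?E + ?N) / A_fun R2 a)"
    using a by (intro mult_left_mono) auto
  also have "\<dots> = (R2 - a) * R2\<^sup>2 / A_fun R2 a * (?E + ?N)" by simp
  finally have "(R2 - a) * \<bar>?M - 1 / A_fun R2 a\<bar> \<le> (R2 - a) * R2\<^sup>2 / A_fun R2 a * (?E + ?N)" .
  moreover have "a \<in> {R1..R2}" using a by simp
  ultimately show ?thesis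
    using L1_norm_le[of a "1 / A_fun R2 a"] unfolding distrib_right mult_1_left by linarith
qed

text \<open>Cauchy-Schwarz, from the nonnegativity in \<open>t\<close> of the integral of
  \<open>(|x - a| - t)^2\<close>.\<close>

lemma first_moment_square_le:
  "(LINT x|\<mu>. \<bar>x - a\<bar>)\<^sup>2 \<le> measure \<mu> UNIV * (LINT x|\<mu>. \<bar>x - a\<bar>\<^sup>2)"
proof -
  let ?M = "measure \<mu> UNIV" and ?E = "LINT x|\<mu>. \<bar>x - a\<bar>" and ?Q = "LINT x|\<mu>. \<bar>x - a\<bar>\<^sup>2"
  have i: "integrable \<mu> (\<lambda>x. \<bar>x - a\<bar>\<^sup>2)" "integrable \<mu> (\<lambda>x. \<bar>x - a\<bar>)"
    by (intro integrable_continuous continuous_intros)+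
  have quad: "0 \<le> ?Q - 2 * t * ?E + t\<^sup>2 * ?M" for t
  proof -
    have "0 \<le> (LINT x|\<mu>. (\<bar>x - a\<bar> - t)\<^sup>2)" by simp
    also have "(LINT x|\<mu>. (\<bar>x - a\<bar> - t)\<^sup>2) = (LINT x|\<mu>. \<bar>x - a\<bar>\<^sup>2 - (2 * t) * \<bar>x - a\<bar> + t\<^sup>2)"
      by (intro Bochner_Integration.integral_cong) (auto simp: power2_diff)
    also have "\<dots> = ?Q - 2 * t * ?E + t\<^sup>2 * ?M"
    proof -
      have gen: "(LINT x|\<mu>. f x - c * g x + d) = (LINT x|\<mu>. f x) - c * (LINT x|\<mu>. g x) + d * ?M"
        if "integrable \<mu> f" "integrable \<mu> g" for f g :: "real \<Rightarrow> real" and c d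
        using that by (simp add: m.borel_UNIV)
      show ?thesis by (rule gen[OF i])
    qed
    finally show ?thesis .
  qed
  show ?thesis
  proof (cases "?M = 0")
    case True
    have "?E = 0"
    proof (rule ccontr)
      assume ne: "?E \<noteq> 0"
      \<comment> \<open>With zero mass the quadratic is affine in \<open>t\<close>; this
        \<open>t\<close> would make it equal to \<open>- ?Q - 2 < 0\<close>.\<close>
      define t where "t = (?Q + 1) / ?E"
      have "0 \<le> ?Q - 2 * (t * ?E)" using quad[of t] True by (simp add: mult.assoc)
      moreover have "t * ?E = ?Q + 1" using ne by (simp add: t_def)
      moreover have "0 \<le> ?Q" by simp
      ultimately show False by linarith
    qed
    then show ?thesis using True by simp
  next
    case False
    then have "0 < ?M" by (simp add: zero_less_measure_iff)
    then show ?thesis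
      \<comment> \<open>The minimizer of the quadratic in \<open>t\<close>.\<close>
      using quad[of "?E / ?M"] by (simp add: field_simps power2_eq_square)
  qed
qed

text \<open>The four summands of the constant are the Lipschitz constants of \<open>P\<close>,
  \<open>m\<close>, \<open>F\<close> and \<open>1/F\<close> relative to \<open>P\<close>; the last
  divides by the square of the common lower bound of \<open>F\<close>.\<close>

lemma profile_distance_le:
  assumes B: "L1_norm (\<lambda>r. u r - u_star M1 R1 R2 r) \<le> B"
  shows "profile_distance M1 M2 R1 R2 u
    \<le> ereal ((1 + (M2 - M1) + 2 * (M2 - M1) / R1 + 2 * (M2 - M1) / R1 / (1 - 2 * M2 / R1)\<^sup>2) * (R2\<^sup>2 * B))"
proof -
  let ?w = "u_star M1 R1 R2"
  define D where "D = R2\<^sup>2 * B"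
  define f0 where "f0 = 1 - 2 * M2 / R1"
  have f0: "0 < f0" using f0_pos by (simp add: f0_def)
  note w = u_star_props[OF M1_pos _ R1_less_R2]
  have M1R1: "2 * M1 < R1" using M1_less_M2 M2_less by simp
  note w = w[OF M1R1]
  have [measurable]: "P_fun R1 u \<in> borel_measurable borel" "P_fun R1 ?w \<in> borel_measurable borel"
    using P_meas P_fun_mono[OF w(1,2)] R1_pos by (auto intro: borel_measurable_mono)
  have P: "\<bar>P_fun R1 u r - P_fun R1 ?w r\<bar> \<le> D" if "r \<in> {R1..R2}" for r
  proof -
    have "\<bar>P_fun R1 u r - P_fun R1 ?w r\<bar> \<le> R2\<^sup>2 * L1_norm (\<lambda>r. u r - ?w r)"
      using that R1_pos by (intro P_fun_diff_le u_integrable w) auto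
    also have "\<dots> \<le> D" unfolding D_def using B by (intro mult_left_mono) auto
    finally show ?thesis .
  qed
  \<comment> \<open>\<open>B\<close> is an arbitrary upper bound, so the sign of \<open>D\<close> is
    read off from an absolute value that it dominates.\<close>
  have D0: "0 \<le> D" using P[of R1] R1_less_R2 by force
  have m: "\<bar>m_fun M1 M2 R1 u r - m_fun M1 M2 R1 ?w r\<bar> \<le> (M2 - M1) * D" if "r \<in> {R1..R2}" for r
  proof -
    have "m_fun M1 M2 R1 u r - m_fun M1 M2 R1 ?w r = (M2 - M1) * (P_fun R1 u r - P_fun R1 ?w r)"
      by (simp add: m_fun_def algebra_simps)
    then show ?thesis using P[OF that] M1_less_M2 by (simp add: abs_mult)
  qed
  have F: "\<bar>F_fun M1 M2 R1 u r - F_fun M1 M2 R1 ?w r\<bar> \<le> 2 * (M2 - M1) / R1 * D" if "r \<in> {R1..R2}" for r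
  proof -
    have "F_fun M1 M2 R1 u r - F_fun M1 M2 R1 ?w r
        = - 2 / r * (m_fun M1 M2 R1 u r - m_fun M1 M2 R1 ?w r)"
      by (simp add: F_fun_def algebra_simps diff_divide_distrib)
    then have "\<bar>F_fun M1 M2 R1 u r - F_fun M1 M2 R1 ?w r\<bar>
        = 2 * \<bar>m_fun M1 M2 R1 u r - m_fun M1 M2 R1 ?w r\<bar> / r"
      using that R1_pos by (simp only: abs_mult) simp
    also have "\<dots> \<le> 2 * ((M2 - M1) * D) / R1"
      using m[OF that] that R1_pos by (intro frac_le) auto
    finally show ?thesis by (simp add: algebra_simps)
  qed
  have Finv: "\<bar>inverse (F_fun M1 M2 R1 u r) - inverse (F_fun M1 M2 R1 ?w r)\<bar>
      \<le> 2 * (M2 - M1) / R1 / f0\<^sup>2 * D" if r: "r \<in> {R1..R2}" for r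
  proof -
    have Fu: "f0 \<le> F_fun M1 M2 R1 u r" using F_bounds[OF r] by (simp add: f0_def)
    have Fw: "f0 \<le> F_fun M1 M2 R1 ?w r"
      unfolding f0_def using r R1_pos P_fun_bounds[OF w(1,2) _ w(3), of r]
      by (intro F_fun_bounds M1_pos M1_less_M2 M2_less) auto
    have "\<bar>inverse (F_fun M1 M2 R1 u r) - inverse (F_fun M1 M2 R1 ?w r)\<bar>
        = \<bar>F_fun M1 M2 R1 u r - F_fun M1 M2 R1 ?w r\<bar> / (F_fun M1 M2 R1 u r * F_fun M1 M2 R1 ?w r)"
      using Fu Fw f0 by (simp add: inverse_diff_inverse abs_mult divide_inverse)
    also have "\<dots> \<le> (2 * (M2 - M1) / R1 * D) / (f0 * f0)"
      using F[OF r] Fu Fw f0 by (intro frac_le mult_mono) auto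
    finally show ?thesis by (simp add: power2_eq_square)
  qed
  have "profile_distance M1 M2 R1 R2 u \<le> ereal D + ereal ((M2 - M1) * D) + ereal (2 * (M2 - M1) / R1 * D)
      + ereal (2 * (M2 - M1) / R1 / f0\<^sup>2 * D)"
    unfolding profile_distance_def Let_def
    by (intro add_mono Linf_norm_le P m F Finv) (unfold F_fun_def m_fun_def, measurable)
  also have "\<dots> = ereal ((1 + (M2 - M1) + 2 * (M2 - M1) / R1 + 2 * (M2 - M1) / R1 / f0\<^sup>2) * D)"
    by (simp add: algebra_simps)
  finally show ?thesis by (simp add: D_def f0_def)
qed

text \<open>The gap controls the second moment of \<open>\<mu>\<close>. Since
  \<open>d \<le> 1\<close>, the total mass is at most \<open>(l + 1) / R1^3\<close>, so
  Cauchy-Schwarz bounds the first moment by a multiple of \<open>sqrt d\<close>; the linear term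
  from \<open>\<nu>\<close> is absorbed through \<open>d \<le> sqrt d\<close>.\<close>

lemma quadratic_gap_estimates:
  fixes a c l :: real
  defines "d \<equiv> J M1 M2 R1 R2 u - l"
  assumes a: "R1 \<le> a" "a < R2" and "0 < c" "0 < l" and "d \<le> 1"
    and gap: "\<forall>x \<in> {R1..R2}. c * (x - a)\<^sup>2 \<le> q_fun M1 x - l * A_fun R2 x"
  shows "0 \<le> d" and "(LINT x|\<mu>. \<bar>x - a\<bar>\<^sup>2) \<le> 1 / c * d"
    and "(LINT x|\<nu>. R2 - x) \<le> 3 / (l * R2\<^sup>2) * d"
    and "L1_norm (\<lambda>r. u r - 1 / A_fun R2 a * indicator {a<..<R2} r)
      \<le> ((R2 - a) * R2\<^sup>2 / A_fun R2 a + 1) * (sqrt ((l + 1) / R1 ^ 3 / c) + 3 / (l * R2\<^sup>2)) * sqrt d"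
proof -
  let ?E = "LINT x|\<mu>. \<bar>x - a\<bar>" and ?Q = "LINT x|\<mu>. \<bar>x - a\<bar>\<^sup>2" and ?N = "LINT x|\<nu>. R2 - x"
  have mb: "?Q \<le> d / c" "?N \<le> 3 / (l * R2\<^sup>2) * d"
    unfolding d_def using \<open>0 < c\<close> \<open>0 < l\<close> gap
    by (intro moment_bounds(1)[where c = c and l = l] moment_bounds(2)[where c = c and k = "\<lambda>x. \<bar>x - a\<bar>\<^sup>2"];
        auto intro!: continuous_intros)+
  show "?Q \<le> 1 / c * d" "?N \<le> 3 / (l * R2\<^sup>2) * d" using mb by auto
  have Q0: "0 \<le> ?Q" by simp
  with mb(1) have "0 \<le> d / c" by linarith
  with \<open>0 < c\<close> show d0: "0 \<le> d" by (simp add: zero_le_divide_iff)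
  have sqrt_d: "d \<le> sqrt d"
    using d0 \<open>d \<le> 1\<close> by (intro real_le_rsqrt) (auto simp: power2_eq_square intro: mult_left_le)
  have "R1 ^ 3 * measure \<mu> UNIV \<le> l + 1" using total_mass_le \<open>d \<le> 1\<close> by (simp add: d_def)
  then have mass: "measure \<mu> UNIV \<le> (l + 1) / R1 ^ 3" using R1_pos by (simp add: field_simps)
  have "?E\<^sup>2 \<le> measure \<mu> UNIV * ?Q" by (rule first_moment_square_le)
  also have "\<dots> \<le> (l + 1) / R1 ^ 3 * (d / c)"
    using mass mb(1) Q0 by (intro mult_mono) (auto intro: order_trans[OF measure_nonneg])
  finally have "?E \<le> sqrt ((l + 1) / R1 ^ 3 * (d / c))" by (rule real_le_rsqrt)
  also have "\<dots> = sqrt ((l + 1) / R1 ^ 3 / c) * sqrt d"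
    by (simp flip: real_sqrt_mult)
  finally have E: "?E \<le> sqrt ((l + 1) / R1 ^ 3 / c) * sqrt d" .
  have "?N \<le> 3 / (l * R2\<^sup>2) * sqrt d"
    using mb(2) mult_left_mono[OF sqrt_d, of "3 / (l * R2\<^sup>2)"] \<open>0 < l\<close> by simp
  with E have "?E + ?N \<le> (sqrt ((l + 1) / R1 ^ 3 / c) + 3 / (l * R2\<^sup>2)) * sqrt d"
    by (simp add: distrib_right)
  then have "((R2 - a) * R2\<^sup>2 / A_fun R2 a + 1) * (?E + ?N)
      \<le> ((R2 - a) * R2\<^sup>2 / A_fun R2 a + 1) * ((sqrt ((l + 1) / R1 ^ 3 / c) + 3 / (l * R2\<^sup>2)) * sqrt d)"
    using a R1_pos A_fun_pos[of a R2] by (intro mult_left_mono) auto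
  with L1_norm_le_moments[OF a]
  show "L1_norm (\<lambda>r. u r - 1 / A_fun R2 a * indicator {a<..<R2} r)
      \<le> ((R2 - a) * R2\<^sup>2 / A_fun R2 a + 1) * (sqrt ((l + 1) / R1 ^ 3 / c) + 3 / (l * R2\<^sup>2)) * sqrt d"
    by (simp only: mult.assoc)
qed

text \<open>The gap now controls the first moment of \<open>\<mu>\<close> directly, so the
  \<open>L1\<close> bound stays linear in \<open>d\<close>.\<close>

lemma linear_gap_estimates:
  fixes c l :: real
  defines "d \<equiv> J M1 M2 R1 R2 u - l"
  assumes "0 < c" "0 < l"
    and gap: "\<forall>x \<in> {R1..R2}. c * (x - R1) \<le> q_fun M1 x - l * A_fun R2 x"
  shows "0 \<le> d" and "(LINT x|\<mu>. x - R1) \<le> 1 / c * d"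
    and "(LINT x|\<nu>. R2 - x) \<le> 3 / (l * R2\<^sup>2) * d"
    and "L1_norm (\<lambda>r. u r - 1 / A_fun R2 R1 * indicator {R1<..<R2} r)
      \<le> ((R2 - R1) * R2\<^sup>2 / A_fun R2 R1 + 1) * (1 / c + 3 / (l * R2\<^sup>2)) * d"
proof -
  let ?E = "LINT x|\<mu>. \<bar>x - R1\<bar>" and ?N = "LINT x|\<nu>. R2 - x"
  have gap': "c * \<bar>x - R1\<bar> \<le> q_fun M1 x - l * A_fun R2 x" if "x \<in> {R1..R2}" for x
    using gap that by simp
  have mb: "?E \<le> d / c" "?N \<le> 3 / (l * R2\<^sup>2) * d"
    unfolding d_def using \<open>0 < c\<close> \<open>0 < l\<close> gap'
    by (intro moment_bounds(1)[where c = c and l = l] moment_bounds(2)[where c = c and k = "\<lambda>x. \<bar>x - R1\<bar>"];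
        auto intro!: continuous_intros)+
  have "0 \<le> ?E" by simp
  with mb(1) have "0 \<le> d / c" by linarith
  with \<open>0 < c\<close> show d0: "0 \<le> d" by (simp add: zero_le_divide_iff)
  have "(LINT x|\<mu>. x - R1) \<le> ?E"
    by (intro integral_mono integrable_continuous continuous_intros) auto
  with mb(1) show "(LINT x|\<mu>. x - R1) \<le> 1 / c * d" by simp
  show "?N \<le> 3 / (l * R2\<^sup>2) * d" by (rule mb)
  have "?E + ?N \<le> (1 / c + 3 / (l * R2\<^sup>2)) * d" using mb by (simp add: distrib_right)
  then have "((R2 - R1) * R2\<^sup>2 / A_fun R2 R1 + 1) * (?E + ?N)
      \<le> ((R2 - R1) * R2\<^sup>2 / A_fun R2 R1 + 1) * ((1 / c + 3 / (l * R2\<^sup>2)) * d)"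
    using R1_pos R1_less_R2 A_fun_pos[of R1 R2] by (intro mult_left_mono) auto
  with L1_norm_le_moments[OF order_refl R1_less_R2]
  show "L1_norm (\<lambda>r. u r - 1 / A_fun R2 R1 * indicator {R1<..<R2} r)
      \<le> ((R2 - R1) * R2\<^sup>2 / A_fun R2 R1 + 1) * (1 / c + 3 / (l * R2\<^sup>2)) * d"
    by (simp only: mult.assoc)
qed

end

section \<open>Choice of the constant in the two regimes\<close>

theorem theorem4p4:
  fixes M1 M2 R1 R2 :: real
  assumes "0 < M1" and "M1 < M2" and "2 * M2 < R1" and "R1 < R2"
  shows "\<exists>C::real. \<forall>u \<in> A_BV R1 R2. deficit M1 M2 R1 R2 u \<le> 1 \<longrightarrow>
     (a_opt M1 R1 R2 = x0 M1 R2 \<longrightarrow>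
        (LINT r|Du_pos u. \<bar>r - a_opt M1 R1 R2\<bar>\<^sup>2) \<le> C * deficit M1 M2 R1 R2 u \<and>
        (LINT r|Du_neg u. R2 - r) \<le> C * deficit M1 M2 R1 R2 u \<and>
        L1_norm (\<lambda>r. u r - u_star M1 R1 R2 r) \<le> C * sqrt (deficit M1 M2 R1 R2 u) \<and>
        profile_distance M1 M2 R1 R2 u \<le> ereal (C * sqrt (deficit M1 M2 R1 R2 u))) \<and>
     (a_opt M1 R1 R2 = R1 \<and> x0 M1 R2 < R1 \<longrightarrow>
        (LINT r|Du_pos u. r - R1) \<le> C * deficit M1 M2 R1 R2 u \<and>
        (LINT r|Du_neg u. R2 - r) \<le> C * deficit M1 M2 R1 R2 u \<and>
        L1_norm (\<lambda>r. u r - u_star M1 R1 R2 r) \<le> C * deficit M1 M2 R1 R2 u \<and>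
        profile_distance M1 M2 R1 R2 u \<le> ereal (C * deficit M1 M2 R1 R2 u))"
proof -
  \<comment> \<open>The ingredients of \<open>C\<close>, none depending on \<open>u\<close>: the
    sign of \<open>p\<close>, the cubic at \<open>a\<close>, separates the regimes; \<open>K\<close>
    passes from first moments to \<open>L1\<close>, \<open>N\<close> bounds the moment of
    \<open>\<nu>\<close>, and \<open>D\<close> passes from \<open>L1\<close> to the
    profiles.\<close>
  define a l where "a = a_opt M1 R1 R2" and "l = lambda_star M1 R1 R2"
  define p where "p = M1 * a ^ 3 + 3 * R2 ^ 3 * a - 7 * M1 * R2 ^ 3"
  define K N where "K = (R2 - a) * R2\<^sup>2 / A_fun R2 a + 1" and "N = 3 / (l * R2\<^sup>2)"
  define D where "D = (1 + (M2 - M1) + 2 * (M2 - M1) / R1 + 2 * (M2 - M1) / R1 / (1 - 2 * M2 / R1)\<^sup>2) * R2\<^sup>2"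
  have R: "0 < R1" "2 * M1 < R1" "2 * M1 < R2" "0 < R2" using assms by auto
  note root = x0_root[OF assms(1) R(3)]
  have a: "R1 \<le> a" "a < R2" using root(2) assms by (auto simp: a_def a_opt_def)
  have a2: "2 * M1 < a" "0 < a" using a R by auto
  have Apos: "0 < A_fun R2 a" using a2 a by (intro A_fun_pos) auto
  have l: "l = Psi M1 R2 a" by (simp add: l_def lambda_star_def a_def)
  have l0: "0 < l" using Apos q_fun_pos[OF assms(1) a2(1)] by (simp add: l Psi_def)
  have us: "u_star M1 R1 R2 r = 1 / A_fun R2 a * indicator {a<..<R2} r" for r
    by (simp add: u_star_def H_star_def a_def)
  have K0: "0 \<le> K" using a Apos by (simp add: K_def)
  have N0: "0 \<le> N" using l0 by (simp add: N_def)
  have D0: "0 \<le> D" unfolding D_def using assms R by (intro mult_nonneg_nonneg add_nonneg_nonneg) auto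
  note gap = gap_lower_bound[OF assms(1) a2(1) a(2), folded p_def l]
  have adm: "admissible_mass R1 R2 u M1 M2" if "u \<in> A_BV R1 R2" for u
    using that assms R by unfold_locales
  have profile: "profile_distance M1 M2 R1 R2 u \<le> ereal (D * B)"
    if "u \<in> A_BV R1 R2" "L1_norm (\<lambda>r. u r - u_star M1 R1 R2 r) \<le> B" for u B
    using admissible_mass.profile_distance_le[OF adm[OF that(1)] that(2)] by (simp only: D_def mult.assoc)
  show ?thesis
  proof (cases "a = x0 M1 R2")
    case True
    \<comment> \<open>At the root of the cubic the linear term of the gap bound vanishes, leaving
      the quadratic coefficient.\<close>
    define c where "c = 2 / 3 * a * l"
    have c0: "0 < c" using a2 l0 by (simp add: c_def)
    have p0: "p = 0" using root(1) by (simp add: p_def True)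
    define L where "L = K * (sqrt ((l + 1) / R1 ^ 3 / c) + N)"
    have L0: "0 \<le> L" using K0 N0 l0 c0 R by (simp add: L_def)
    define C where "C = 1 / c + N + L + D * L"
    have C: "1 / c \<le> C" "N \<le> C" "L \<le> C" "D * L \<le> C"
      using c0 N0 L0 D0 mult_nonneg_nonneg[OF D0 L0] by (auto simp: C_def)
    have gap': "\<forall>x \<in> {R1..R2}. c * (x - a)\<^sup>2 \<le> q_fun M1 x - l * A_fun R2 x"
      using gap R by (simp add: p0 c_def)
    show ?thesis
    proof (intro exI[of _ C] ballI impI conjI)
      fix u assume u: "u \<in> A_BV R1 R2" and "deficit M1 M2 R1 R2 u \<le> 1"
      interpret admissible_mass R1 R2 u M1 M2 by (rule adm[OF u])
      define d where "d = deficit M1 M2 R1 R2 u"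
      have dJ: "d = J M1 M2 R1 R2 u - l" by (simp add: d_def deficit_def l_def)
      have "J M1 M2 R1 R2 u - l \<le> 1" using \<open>deficit M1 M2 R1 R2 u \<le> 1\<close> by (simp add: deficit_def l_def)
      note est = quadratic_gap_estimates[OF a c0 l0 this gap', folded dJ K_def N_def, folded us L_def]
      have mono: "x \<le> C * d" if "x \<le> k * d" "k \<le> C" for x k
        using that est(1) by (meson mult_right_mono order_trans)
      have mono': "x \<le> C * sqrt d" if "x \<le> k * sqrt d" "k \<le> C" for x k
        using that est(1) by (meson mult_right_mono order_trans real_sqrt_ge_zero)
      show "(LINT r|Du_pos u. \<bar>r - a_opt M1 R1 R2\<bar>\<^sup>2) \<le> C * deficit M1 M2 R1 R2 u"
        using mono[OF est(2) C(1)] by (simp only: d_def a_def)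
      show "(LINT r|Du_neg u. R2 - r) \<le> C * deficit M1 M2 R1 R2 u"
        using mono[OF est(3) C(2)] by (simp only: d_def)
      show "L1_norm (\<lambda>r. u r - u_star M1 R1 R2 r) \<le> C * sqrt (deficit M1 M2 R1 R2 u)"
        using mono'[OF est(4) C(3)] by (simp only: d_def)
      have "profile_distance M1 M2 R1 R2 u \<le> ereal (D * L * sqrt d)"
        using profile[OF u est(4)] by (simp only: mult.assoc)
      also have "\<dots> \<le> ereal (C * sqrt d)" using mono'[OF order_refl C(4)] by simp
      finally show "profile_distance M1 M2 R1 R2 u \<le> ereal (C * sqrt (deficit M1 M2 R1 R2 u))"
        by (simp only: d_def)
    \<comment> \<open>The second regime is contradictory here: it would require both
      \<open>a = R1\<close> and \<open>x0 < R1\<close> although \<open>a = x0\<close>.\<close>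
    qed (use True in \<open>auto simp: a_def\<close>)
  next
    case False
    then have aR: "a = R1" and xR: "x0 M1 R2 < R1" by (auto simp: a_def a_opt_def max_def split: if_splits)
    have p0: "0 < p"
      using cubic_strict_mono[OF assms(1) R(4) xR] root(1) by (simp add: p_def aR)
    \<comment> \<open>The slope of the gap at \<open>a = R1\<close>, positive because the cubic is
      positive beyond its root; the quadratic term is nonnegative and is dropped.\<close>
    define c where "c = q_fun M1 a * p / (a * (a - 2 * M1) * (R2 ^ 3 - a ^ 3))"
    have c0: "0 < c"
      using p0 a a2 q_fun_pos[OF assms(1) a2(1)] Apos by (simp add: c_def A_fun_def)
    define L where "L = K * (1 / c + N)"
    have L0: "0 \<le> L" using K0 N0 c0 by (simp add: L_def)
    define C where "C = 1 / c + N + L + D * L"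
    have C: "1 / c \<le> C" "N \<le> C" "L \<le> C" "D * L \<le> C"
      using c0 N0 L0 D0 mult_nonneg_nonneg[OF D0 L0] by (auto simp: C_def)
    have gap': "\<forall>x \<in> {R1..R2}. c * (x - R1) \<le> q_fun M1 x - l * A_fun R2 x"
    proof
      fix x assume "x \<in> {R1..R2}"
      then have "2 * M1 < x" "x \<le> R2" using R by auto
      moreover have "0 \<le> 2 / 3 * a * l * (x - a)\<^sup>2" using a2 l0 by simp
      ultimately show "c * (x - R1) \<le> q_fun M1 x - l * A_fun R2 x"
        using gap[of x] unfolding c_def[symmetric] aR[symmetric] by linarith
    qed
    have ne: "(a_opt M1 R1 R2 = x0 M1 R2) = False" using False by (simp add: a_def)
    show ?thesis
      unfolding ne simp_thms
    proof (intro exI[of _ C] ballI impI conjI)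
      fix u assume u: "u \<in> A_BV R1 R2"
      interpret admissible_mass R1 R2 u M1 M2 by (rule adm[OF u])
      define d where "d = deficit M1 M2 R1 R2 u"
      have dJ: "d = J M1 M2 R1 R2 u - l" by (simp add: d_def deficit_def l_def)
      \<comment> \<open>Folding \<open>aR\<close> rewrites \<open>R1\<close> as \<open>a\<close>, so
        that the constants defined through \<open>a\<close> are recognised.\<close>
      note est = linear_gap_estimates[OF c0 l0 gap', folded dJ aR, folded K_def N_def, folded us L_def]
      have mono: "x \<le> C * d" if "x \<le> k * d" "k \<le> C" for x k
        using that est(1) by (meson mult_right_mono order_trans)
      show "(LINT r|Du_pos u. r - R1) \<le> C * deficit M1 M2 R1 R2 u"
        using mono[OF est(2) C(1)] by (simp only: d_def aR)
      show "(LINT r|Du_neg u. R2 - r) \<le> C * deficit M1 M2 R1 R2 u"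
        using mono[OF est(3) C(2)] by (simp only: d_def)
      show "L1_norm (\<lambda>r. u r - u_star M1 R1 R2 r) \<le> C * deficit M1 M2 R1 R2 u"
        using mono[OF est(4) C(3)] by (simp only: d_def)
      have "profile_distance M1 M2 R1 R2 u \<le> ereal (D * L * d)"
        using profile[OF u est(4)] by (simp only: mult.assoc)
      also have "\<dots> \<le> ereal (C * d)" using mono[OF order_refl C(4)] by simp
      finally show "profile_distance M1 M2 R1 R2 u \<le> ereal (C * deficit M1 M2 R1 R2 u)"
        by (simp only: d_def)
    qed
  qed
qed

end
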